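(* Let $T>0$, let $u_0\in H^3(\mathbb{T}^3)\cap H$ (so in particular $\nabla\cdot u_0=0$), and let $u$ be a weak solution on $(0,T)\times\mathbb{T}^3$ to the incompressible Euler equations $$\partial_t u+(u\cdot\nabla)u+\nabla p=0,\qquad \operatorname{div}u=0,\qquad u(0,x)=u_0(x).$$ Assume that $u$ is a Beltrami solution with proportionality factor depending only on time: $\nabla\times u(t,x)=\lambda(t)\,u(t,x)$ for some scalar function $\lambda\in L^p(0,T)$ with $p\ge 3$. Then $u$ is the unique classical solution of the Euler equations on $[0,T]$ with initial datum $u_0$, and it conserves the kinetic energy, i.e. $\|u(t)\|_{L^2(\mathbb{T}^3)}=\|u_0\|_{L^2(\mathbb{T}^3)}$ for $t\in[0,T]$.
   Context: $\mathbb{T}^3=\mathbb{R}^3/\mathbb{Z}^3$ is the three-dimensional torus. $(\cdot,\cdot)$ is the scalar product of $L^2(\mathbb{T}^3)$. $H$ is the closure in $L^2(\mathbb{T}^3)$ of the smooth, periodic, divergence-free, zero-mean vector fields $\mathbb{T}^3\to\mathbb{R}^3$; $H^3(\mathbb{T}^3)=W^{3,2}(\mathbb{T}^3)$ is the usual Sobolev space. Weak solution: given $u_0\in H$, a measurable function $u:(0,T)\times\mathbb{T}^3\to\mathbb{R}^3$ is a weak solution to the Euler equations with initial datum $u_0$ if $u\in L^\infty(0,T;H)$ and $$\int_0^T\big[(u,\partial_t\varphi)+(u\otimes u,\nabla\varphi)\big]\,dt=-(u_0,\varphi(0))$$ for all $\varphi\in\mathcal{D}_T=\{\varphi\in C_0^\infty([0,T);C^\infty(\mathbb{T}^3)):\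 \nabla\cdot\varphi=0\}$ (vector-valued test functions, compactly supported in time in $[0,T)$). The curl $\nabla\times u$ is taken in the sense of distributions in $x$, and the Beltrami relation holds for a.e. $t$. "Classical solution" has its usual meaning: (after modification on a null set) $u$ is continuously differentiable in $(t,x)$ and, with some pressure $p$, satisfies the equations pointwise and attains the initial datum $u_0$. *)

theory Defs
  imports "HOL-Analysis.Analysis"
begin

text \<open>
  Functions on $R^3/Z^3$ are represented by $Z^3$-periodic functions on \<open>real ^ 3\<close>;
  integrals over the torus are integrals over the unit cube.
\<close>

definition periodic :: "(real ^ 3 \<Rightarrow> 'b) \<Rightarrow> bool" where
  "periodic f \<longleftrightarrow> (\<forall>x k. (\<forall>i. k $ i \<in> \<int>) \<longrightarrow> f (x + k) = f x)"

definition torus :: "(real ^ 3) measure" where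
  "torus = lebesgue_on (cbox 0 One)"

definition L2 :: "(real ^ 3 \<Rightarrow> 'b::euclidean_space) set" where
  "L2 = {f. periodic f \<and> f \<in> borel_measurable lebesgue
            \<and> integrable torus (\<lambda>x. (norm (f x))\<^sup>2)}"

definition L2_inner :: "(real ^ 3 \<Rightarrow> 'b::euclidean_space) \<Rightarrow> (real ^ 3 \<Rightarrow> 'b) \<Rightarrow> real" where
  "L2_inner f g = (LINT x|torus. f x \<bullet> g x)"

definition L2_norm :: "(real ^ 3 \<Rightarrow> 'b::euclidean_space) \<Rightarrow> real" where
  "L2_norm f = sqrt (L2_inner f f)"

text \<open>
  \<open>C_on k S f\<close>: \<open>f\<close> is $k$ times continuously differentiable on \<open>S\<close>. Derivatives are taken
  within \<open>S\<close>, so they are one-sided at boundary points. The notion is only used for convex \<open>S\<close>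
  with nonempty interior, where derivatives within \<open>S\<close> are unique.
\<close>

primrec C_on :: "nat \<Rightarrow> 'a::euclidean_space set \<Rightarrow> ('a \<Rightarrow> 'b::real_normed_vector) \<Rightarrow> bool" where
  "C_on 0 S f \<longleftrightarrow> continuous_on S f"
| "C_on (Suc k) S f \<longleftrightarrow> f differentiable_on S
     \<and> (\<forall>v. C_on k S (\<lambda>x. frechet_derivative f (at x within S) v))"

definition smooth_on :: "'a::euclidean_space set \<Rightarrow> ('a \<Rightarrow> 'b::real_normed_vector) \<Rightarrow> bool" where
  "smooth_on S f \<longleftrightarrow> (\<forall>k. C_on k S f)"

definition smooth_torus :: "(real ^ 3 \<Rightarrow> 'b::euclidean_space) set" where
  "smooth_torus = {f. periodic f \<and> smooth_on UNIV f}"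

definition partial :: "3 \<Rightarrow> (real ^ 3 \<Rightarrow> 'b::real_normed_vector) \<Rightarrow> real ^ 3 \<Rightarrow> 'b" where
  "partial i f x = frechet_derivative f (at x) (axis i 1)"

definition grad :: "(real ^ 3 \<Rightarrow> real) \<Rightarrow> real ^ 3 \<Rightarrow> real ^ 3" where
  "grad f x = (\<chi> i. partial i f x)"

text \<open>The entry \<open>Jac f x $ i $ j\<close> is the $j$-th partial derivative of the $i$-th component.\<close>

definition Jac :: "(real ^ 3 \<Rightarrow> real ^ 3) \<Rightarrow> real ^ 3 \<Rightarrow> real ^ 3 ^ 3" where
  "Jac f x = jacobian f (at x)"

definition div_field :: "(real ^ 3 \<Rightarrow> real ^ 3) \<Rightarrow> real ^ 3 \<Rightarrow> real" where
  "div_field f x = trace (Jac f x)"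

definition curl :: "(real ^ 3 \<Rightarrow> real ^ 3) \<Rightarrow> real ^ 3 \<Rightarrow> real ^ 3" where
  "curl f x = vector
     [partial 2 f x $ 3 - partial 3 f x $ 2,
      partial 3 f x $ 1 - partial 1 f x $ 3,
      partial 1 f x $ 2 - partial 2 f x $ 1]"

definition outer :: "real ^ 3 \<Rightarrow> real ^ 3 \<Rightarrow> real ^ 3 ^ 3" where
  "outer a b = (\<chi> i j. a $ i * b $ j)"

text \<open>
  \<open>w\<close> is the curl of \<open>f\<close> in the sense of distributions: the curl is formally self-adjoint, the
  two sign changes (integration by parts, antisymmetry of the cross product) cancelling.
\<close>

definition has_distr_curl :: "(real ^ 3 \<Rightarrow> real ^ 3) \<Rightarrow> (real ^ 3 \<Rightarrow> real ^ 3) \<Rightarrow> bool" where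
  "has_distr_curl f w \<longleftrightarrow> (\<forall>\<psi>\<in>smooth_torus. L2_inner w \<psi> = L2_inner f (curl \<psi>))"

text \<open>A list \<open>is\<close> of directions encodes a multi-index; \<open>g\<close> is the corresponding weak derivative.\<close>

definition has_weak_derivative ::
  "3 list \<Rightarrow> (real ^ 3 \<Rightarrow> 'b::euclidean_space) \<Rightarrow> (real ^ 3 \<Rightarrow> 'b) \<Rightarrow> bool" where
  "has_weak_derivative is f g \<longleftrightarrow>
     (\<forall>\<psi>\<in>smooth_torus. L2_inner g \<psi> = (-1) ^ length is * L2_inner f (foldr partial is \<psi>))"

definition Sobolev2 :: "nat \<Rightarrow> (real ^ 3 \<Rightarrow> 'b::euclidean_space) set" where
  "Sobolev2 k = {f\<in>L2. \<forall>is. length is \<le> k \<longrightarrow> (\<exists>g\<in>L2. has_weak_derivative is f g)}"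

definition H_space :: "(real ^ 3 \<Rightarrow> real ^ 3) set" where
  "H_space = {f\<in>L2. \<forall>\<epsilon>>0. \<exists>g\<in>smooth_torus.
      (\<forall>x. div_field g x = 0) \<and> (LINT x|torus. g x) = 0 \<and> L2_norm (\<lambda>x. f x - g x) < \<epsilon>}"

definition Lp_interval :: "ennreal \<Rightarrow> real \<Rightarrow> (real \<Rightarrow> real) set" where
  "Lp_interval p T = {f \<in> borel_measurable (lebesgue_on {0<..<T}).
     if p = \<infinity> then \<exists>C. AE t in lebesgue_on {0<..<T}. \<bar>f t\<bar> \<le> C
     else integrable (lebesgue_on {0<..<T}) (\<lambda>t. \<bar>f t\<bar> powr enn2real p)}"

text \<open>
  $L^\infty(0,T;H)$, for functions given as jointly measurable functions of time and space (which
  implies strong measurability as an \<open>L2\<close>-valued map).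
\<close>

definition Linf_H :: "real \<Rightarrow> (real \<Rightarrow> real ^ 3 \<Rightarrow> real ^ 3) set" where
  "Linf_H T = {u. (\<forall>t\<in>{0<..<T}. periodic (u t))
     \<and> (\<lambda>(t, x). u t x) \<in> borel_measurable (lebesgue_on ({0<..<T} \<times> UNIV))
     \<and> (\<exists>C. AE t in lebesgue_on {0<..<T}. u t \<in> H_space \<and> L2_norm (u t) \<le> C)}"

text \<open>
  Compact support in $[0,T)$ only forces \<open>\<phi>\<close> to vanish near time $T$; \<open>\<phi> 0\<close> is unrestricted.
\<close>

definition test_functions :: "real \<Rightarrow> (real \<Rightarrow> real ^ 3 \<Rightarrow> real ^ 3) set" where
  "test_functions T = {\<phi>.
     smooth_on ({0..<T} \<times> UNIV) (\<lambda>(t, x). \<phi> t x)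
     \<and> (\<forall>t\<in>{0..<T}. periodic (\<phi> t) \<and> (\<forall>x. div_field (\<phi> t) x = 0))
     \<and> (\<exists>T'<T. \<forall>t\<in>{0..<T}. T' \<le> t \<longrightarrow> (\<forall>x. \<phi> t x = 0))}"

definition weak_Euler ::
  "real \<Rightarrow> (real ^ 3 \<Rightarrow> real ^ 3) \<Rightarrow> (real \<Rightarrow> real ^ 3 \<Rightarrow> real ^ 3) \<Rightarrow> bool" where
  "weak_Euler T u0 u \<longleftrightarrow> u \<in> Linf_H T \<and>
     (\<forall>\<phi>\<in>test_functions T.
        (LINT t|lebesgue_on {0<..<T}.
            L2_inner (u t) (\<lambda>x. vector_derivative (\<lambda>s. \<phi> s x) (at t))
          + L2_inner (\<lambda>x. outer (u t x) (u t x)) (Jac (\<phi> t)))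
        = - L2_inner u0 (\<phi> 0))"

text \<open>
  The pressure is a function on the torus, i.e. periodic. The initial datum is an element of
  \<open>L2\<close>, hence attained almost everywhere.
\<close>

definition classical_Euler ::
  "real \<Rightarrow> (real ^ 3 \<Rightarrow> real ^ 3) \<Rightarrow> (real \<Rightarrow> real ^ 3 \<Rightarrow> real ^ 3) \<Rightarrow> bool" where
  "classical_Euler T u0 v \<longleftrightarrow>
     C_on 1 ({0..T} \<times> UNIV) (\<lambda>(t, x). v t x)
     \<and> (\<forall>t\<in>{0..T}. periodic (v t) \<and> (\<forall>x. div_field (v t) x = 0))
     \<and> (\<exists>p. continuous_on ({0..T} \<times> UNIV) (\<lambda>(t, x). p t x)
          \<and> (\<forall>t\<in>{0..T}. periodic (p t) \<and> C_on 1 UNIV (p t)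
              \<and> (\<forall>x. vector_derivative (\<lambda>s. v s x) (at t within {0..T})
                       + Jac (v t) x *v v t x + grad (p t) x = 0)))
     \<and> (AE x in torus. v 0 x = u0 x)"

definition Beltrami ::
  "real \<Rightarrow> (real \<Rightarrow> real) \<Rightarrow> (real \<Rightarrow> real ^ 3 \<Rightarrow> real ^ 3) \<Rightarrow> bool" where
  "Beltrami T lam u \<longleftrightarrow>
     (AE t in lebesgue_on {0<..<T}. has_distr_curl (u t) (\<lambda>x. lam t *\<^sub>R u t x))"

end

theory Submission
  imports Defs "HOL-Real_Asymp.Real_Asymp"
begin

text \<open>
  The solution turns out to be stationary. For almost every $t$, the field $u(t)$ is an eigenfield of
  the curl with eigenvalue $\lambda(t)$. On the Fourier side this reads
  $\lambda\,\hat u(k) = 2\pi i\, k\times\hat u(k)$ with $k\cdot\hat u(k) = 0$, so that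
  $\lambda^2 = 4\pi^2|k|^2$ for every frequency $k$ that occurs. Only finitely many frequencies
  occur, and $u(t)$ is (almost everywhere) a trigonometric polynomial $v$ with
  $\nabla\times v = \lambda v$ pointwise; this is \<open>Beltrami_field_smooth\<close>. It uses the
  completeness of the trigonometric system, which follows from the Stone--Weierstrass theorem,
  \<open>AE_eq_0_if_orthogonal_to_waves\<close>.

  For such $v$ the identity
  $(v\cdot\nabla)v = \nabla\frac{|v|^2}{2} + (\nabla\times v)\times v = \nabla\frac{|v|^2}{2}$
  shows that the nonlinear term vanishes against solenoidal test fields,
  \<open>Beltrami_stress_orthogonal_weak\<close>. The weak formulation then says that the scalar products of
  $u(t)$ with solenoidal waves do not depend on time, \<open>weak_Euler_mode_const\<close>, and therefore
  $u(t) = u_0$ for almost every $t$, \<open>weak_Euler_Beltrami_stationary\<close>. In particular $u_0$ itself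
  agrees almost everywhere with a smooth Beltrami field $v$, the constant-in-time field $v$ is a
  classical solution with pressure $-|v|^2/2$, \<open>Beltrami_stationary_classical\<close>, and conservation
  of energy is trivial. Uniqueness among classical solutions is the usual energy estimate,
  \<open>classical_Euler_unique\<close>.
\<close>

section \<open>Iterated differentiability within a set\<close>

text \<open>
  From every point of the set one can move within it, arbitrarily little, along each coordinate
  axis. On such a set the derivative within the set is unique, even at boundary points.
\<close>

definition approachable :: "'a::euclidean_space set \<Rightarrow> bool" where
  "approachable S \<longleftrightarrow> (\<forall>x\<in>S. \<forall>i\<in>Basis. \<forall>e>0. \<exists>d. 0 < \<bar>d\<bar> \<and> \<bar>d\<bar> < e \<and> x + d *\<^sub>R i \<in> S)"

lemma approachable_UNIV [simp]: "approachable UNIV"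
  unfolding approachable_def
  by (metis UNIV_I abs_of_pos dense)

lemma approachable_interval_times:
  fixes I :: "real set"
  assumes "\<And>t e. \<lbrakk>t \<in> I; e > 0\<rbrakk> \<Longrightarrow> \<exists>d. 0 < \<bar>d\<bar> \<and> \<bar>d\<bar> < e \<and> t + d \<in> I"
  shows "approachable (I \<times> (UNIV :: 'a::euclidean_space set))"
  unfolding approachable_def
proof (intro ballI allI impI)
  fix x i and e :: real
  assume x: "x \<in> I \<times> (UNIV :: 'a set)" and i: "i \<in> (Basis :: (real \<times> 'a) set)" and e: "e > 0"
  consider "i = (1, 0)" | j where "i = (0, j)"
    using i by (auto simp: Basis_prod_def)
  then show "\<exists>d. 0 < \<bar>d\<bar> \<and> \<bar>d\<bar> < e \<and> x + d *\<^sub>R i \<in> I \<times> UNIV"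
  proof cases
    case 1
    then show ?thesis using assms[of "fst x" e] x e by (auto simp: mem_Times_iff)
  next
    case 2
    then show ?thesis using x e by (intro exI[of _ "e/2"]) (auto simp: mem_Times_iff)
  qed
qed

lemma approachable_slabs:
  fixes T :: real
  assumes "T > 0"
  shows "approachable ({0..<T} \<times> (UNIV :: 'a::euclidean_space set))"
    and "approachable ({0..T} \<times> (UNIV :: 'a::euclidean_space set))"
proof -
  have *: "\<exists>d. 0 < \<bar>d\<bar> \<and> \<bar>d\<bar> < e \<and> t + d \<in> {0..<T}" if "0 \<le> t" "t < T" "e > 0" for t e
    using that by (intro exI[of _ "min (e/2) ((T - t)/2)"]) (auto simp: min_def field_simps)
  show "approachable ({0..<T} \<times> (UNIV :: 'a::euclidean_space set))"
    by (rule approachable_interval_times) (use * in auto)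
  show "approachable ({0..T} \<times> (UNIV :: 'a::euclidean_space set))"
  proof (rule approachable_interval_times)
    fix t e :: real assume t: "t \<in> {0..T}" "e > 0"
    show "\<exists>d. 0 < \<bar>d\<bar> \<and> \<bar>d\<bar> < e \<and> t + d \<in> {0..T}"
    proof (cases "t < T")
      case True
      then obtain d where "0 < \<bar>d\<bar> \<and> \<bar>d\<bar> < e \<and> t + d \<in> {0..<T}" using *[of t e] t by auto
      then show ?thesis by (intro exI[of _ d]) auto
    next
      case False
      then show ?thesis using t assms by (intro exI[of _ "- min (e/2) (T/2)"]) (auto simp: min_def)
    qed
  qed
qed

lemma frechet_derivative_within_eq:
  assumes "approachable S" "x \<in> S" "(f has_derivative f') (at x within S)"
  shows "frechet_derivative f (at x within S) = f'"
proof (rule frechet_derivative_unique_within)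
  show "(f has_derivative frechet_derivative f (at x within S)) (at x within S)"
    using assms(3) differentiableI frechet_derivative_works by blast
  show "(f has_derivative f') (at x within S)" by fact
qed (use assms(1,2) in \<open>auto simp: approachable_def\<close>)

lemma frechet_derivative_within_cong:
  assumes "\<And>x. x \<in> S \<Longrightarrow> f x = g x" "x \<in> S"
  shows "frechet_derivative f (at x within S) = frechet_derivative g (at x within S)"
    and "f differentiable (at x within S) \<longleftrightarrow> g differentiable (at x within S)"
proof -
  have "(f has_derivative D) (at x within S) \<longleftrightarrow> (g has_derivative D) (at x within S)" for D
    using assms by (metis has_derivative_transform)
  then show "frechet_derivative f (at x within S) = frechet_derivative g (at x within S)"
    and "f differentiable (at x within S) \<longleftrightarrow> g differentiable (at x within S)"
    by (simp_all add: frechet_derivative_def differentiable_def)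
qed

lemma C_on_cong:
  assumes "\<And>x. x \<in> S \<Longrightarrow> f x = g x"
  shows "C_on k S f \<longleftrightarrow> C_on k S g"
  using assms
proof (induction k arbitrary: f g)
  case 0
  then show ?case by (simp cong: continuous_on_cong)
next
  case (Suc k)
  have "C_on k S (\<lambda>x. frechet_derivative f (at x within S) v)
      \<longleftrightarrow> C_on k S (\<lambda>x. frechet_derivative g (at x within S) v)" for v
    by (rule Suc.IH) (simp add: frechet_derivative_within_cong(1)[OF Suc.prems])
  moreover have "f differentiable_on S \<longleftrightarrow> g differentiable_on S"
    by (simp add: differentiable_on_def frechet_derivative_within_cong(2)[OF Suc.prems])
  ultimately show ?case by simp
qed

text \<open>
  On an approachable set it suffices to exhibit a derivative: it is the one that \<open>C_on\<close> refers to.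
\<close>

lemma C_on_SucI:
  assumes "approachable S" "\<And>x. x \<in> S \<Longrightarrow> (f has_derivative f' x) (at x within S)"
    and "\<And>v. C_on k S (\<lambda>x. f' x v)"
  shows "C_on (Suc k) S f"
proof -
  have "C_on k S (\<lambda>x. frechet_derivative f (at x within S) v)" for v
    using assms(3)[of v]
    by (subst C_on_cong[where g = "\<lambda>x. f' x v"])
       (auto simp: frechet_derivative_within_eq[OF assms(1) _ assms(2)])
  then show ?thesis
    using assms(2) by (auto simp: differentiable_on_def differentiable_def)
qed

lemma C_on_has_derivative:
  assumes "C_on (Suc k) S f" "x \<in> S"
  shows "(f has_derivative frechet_derivative f (at x within S)) (at x within S)"
  using assms frechet_derivative_works by (auto simp: differentiable_on_def)

lemma C_on_add:
  assumes "approachable S" "C_on k S f" "C_on k S g"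
  shows "C_on k S (\<lambda>x. f x + g x)"
  using assms(2,3)
proof (induction k arbitrary: f g)
  case 0
  then show ?case by (auto intro: continuous_on_add)
next
  case (Suc k)
  show ?case
    by (rule C_on_SucI[OF assms(1), where
          f' = "\<lambda>x v. frechet_derivative f (at x within S) v + frechet_derivative g (at x within S) v"])
       (use Suc in \<open>auto intro!: has_derivative_add C_on_has_derivative simp del: C_on.simps\<close>, use Suc in auto)
qed

lemma C_on_scaleR:
  assumes "approachable S" "C_on k S f"
  shows "C_on k S (\<lambda>x. c *\<^sub>R f x)"
  using assms(2)
proof (induction k arbitrary: f)
  case 0
  then show ?case by (auto intro: continuous_intros)
next
  case (Suc k)
  show ?case
    by (rule C_on_SucI[OF assms(1), where f' = "\<lambda>x v. c *\<^sub>R frechet_derivative f (at x within S) v"])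
       (use Suc in \<open>auto intro!: has_derivative_scaleR_right C_on_has_derivative simp del: C_on.simps\<close>, use Suc in auto)
qed

lemma C_on_const:
  assumes "approachable S"
  shows "C_on k S (\<lambda>x. c)"
proof (induction k arbitrary: c)
  case (Suc k)
  show ?case by (rule C_on_SucI[OF assms, where f' = "\<lambda>x v. 0"]) (use Suc in auto)
qed auto

lemma C_on_sum:
  assumes "approachable S" "\<And>i. i \<in> I \<Longrightarrow> C_on k S (f i)"
  shows "C_on k S (\<lambda>x. \<Sum>i\<in>I. f i x)"
  using assms(2)
  by (induction I rule: infinite_finite_induct) (auto intro: C_on_add C_on_const assms(1))

section \<open>The period lattice and plane waves\<close>

text \<open>
  The integer lattice, which is both the period lattice of the torus and its set of frequencies.
\<close>

definition freq :: "(real ^ 3) set" where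
  "freq = {k. \<forall>i. k $ i \<in> \<int>}"

text \<open>
  Real plane waves with a phase. Sine and cosine are treated together: differentiation shifts the
  phase by a quarter of a period, and \<open>pi/2\<close> gives minus the sine.
\<close>

definition wave :: "real ^ 3 \<Rightarrow> real \<Rightarrow> real ^ 3 \<Rightarrow> real" where
  "wave k a x = cos (2 * pi * (k \<bullet> x) + a)"

lemma wave_has_derivative:
  "(wave k a has_derivative (\<lambda>v. 2 * pi * (k \<bullet> v) * wave k (a + pi/2) x)) (at x within S)"
  unfolding wave_def
  by (rule derivative_eq_intros refl | simp add: cos_add sin_add algebra_simps)+

lemma continuous_on_wave [continuous_intros]: "continuous_on S (wave k a)"
  unfolding wave_def by (intro continuous_intros)

lemma wave_add_pi: "wave k (a + pi) x = - wave k a x"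
  by (simp add: wave_def cos_add sin_add)

lemma freq_inner_Ints: "k \<in> freq \<Longrightarrow> m \<in> freq \<Longrightarrow> k \<bullet> m \<in> \<int>"
  by (auto simp: freq_def inner_vec_def)

lemma periodic_wave: 
  assumes "k \<in> freq" shows "periodic (wave k a)"
  unfolding periodic_def
proof (intro allI impI)
  fix x m :: "real^3" assume "\<forall>i. m $ i \<in> \<int>"
  then have "k \<bullet> m \<in> \<int>" using assms freq_inner_Ints by (auto simp: freq_def)
  then obtain n :: int where n: "k \<bullet> m = n" by (auto elim: Ints_cases)
  have "wave k a (x + m) = cos ((2 * pi * (k \<bullet> x) + a) + 2 * pi * n)"
    by (simp add: wave_def n algebra_simps)
  also have "\<dots> = wave k a x"
    by (simp add: wave_def cos_add sin_add cos_int_2pin sin_int_2pin)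
  finally show "wave k a (x + m) = wave k a x" .
qed

lemma wave_C_on: "C_on j UNIV (\<lambda>x. wave k a x *\<^sub>R c)"
proof (induction j arbitrary: a)
  case 0
  show ?case by (auto intro!: continuous_intros)
next
  case (Suc j)
  show ?case
  proof (rule C_on_SucI[where f' = "\<lambda>x v. (2 * pi * (k \<bullet> v) * wave k (a + pi/2) x) *\<^sub>R c"])
    show "((\<lambda>x. wave k a x *\<^sub>R c) has_derivative (\<lambda>v. (2 * pi * (k \<bullet> v) * wave k (a + pi/2) x) *\<^sub>R c)) (at x within UNIV)" for x
      by (rule has_derivative_scaleR_left[OF wave_has_derivative])
    show "C_on j UNIV (\<lambda>x. (2 * pi * (k \<bullet> v) * wave k (a + pi/2) x) *\<^sub>R c)" for v
      using C_on_scaleR[OF approachable_UNIV Suc[of "a + pi/2"], of "2 * pi * (k \<bullet> v)"] by simp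
  qed simp
qed

lemma One_nth: "(One :: real ^ 3) $ i = 1"
proof -
  have "(One :: real ^ 3) \<bullet> axis i 1 = 1"
    by (simp add: axis_in_Basis_iff)
  then show ?thesis by (simp add: inner_axis)
qed

lemma axis_1_nth: "axis i (1::real) $ j = (if j = i then 1 else 0)"
  by (simp add: axis_def)

lemma freq_translate_cube:
  obtains k where "k \<in> freq" "k + x \<in> cbox 0 One"
proof
  let ?k = "\<chi> i. - real_of_int \<lfloor>x $ i\<rfloor>"
  show "?k \<in> freq" by (simp add: freq_def)
  show "?k + x \<in> cbox 0 One"
    by (auto simp: mem_box_cart One_nth simp del: sum_component) linarith+
qed

lemma periodic_eq_0_if_on_cube:
  assumes per: "periodic f" and z: "\<And>x. x \<in> cbox 0 One \<Longrightarrow> f x = 0"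
  shows "f (x :: real ^ 3) = 0"
proof -
  obtain k where k: "k \<in> freq" "k + x \<in> cbox 0 One" by (rule freq_translate_cube)
  then have "f (x + k) = f x" using per unfolding periodic_def freq_def by blast
  then show ?thesis using z[OF k(2)] by (simp add: add.commute)
qed

lemma countable_freq: "countable freq"
proof -
  have "freq \<subseteq> (\<lambda>n. \<chi> i. of_int (n $ i)) ` (UNIV :: (int ^ 3) set)"
  proof
    fix k assume "k \<in> freq"
    then have "\<forall>i. \<exists>n. k $ i = of_int n" by (auto simp: freq_def elim: Ints_cases)
    then have "\<exists>n. \<forall>i. k $ i = of_int (n i)" by (rule choice)
    then obtain n where "\<forall>i. k $ i = of_int (n i)" by blast
    then have "k = (\<lambda>n. \<chi> i. of_int (n $ i)) (\<chi> i. n i)" by (simp add: vec_eq_iff)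
    then show "k \<in> (\<lambda>n. \<chi> i. of_int (n $ i)) ` (UNIV :: (int ^ 3) set)" by blast
  qed
  then show ?thesis by (rule countable_subset) auto
qed

section \<open>Flat functions of time\<close>

text \<open>
  $y^m e^{-1/y}$ for $y>0$, extended by zero. The span of these functions is closed under
  differentiation, so they are smooth; they supply the cut-offs in time.
\<close>

definition flat :: "int \<Rightarrow> real \<Rightarrow> real" where
  "flat m y = (if y \<le> 0 then 0 else y powi m * exp (- 1 / y))"

lemma flat_has_real_derivative:
  "(flat m has_real_derivative (of_int m * flat (m - 1) y + flat (m - 2) y)) (at y)"
proof (cases y "0 :: real" rule: linorder_cases)
  case less
  have "((\<lambda>_. 0) has_real_derivative 0) (at y)" by simp
  moreover have "eventually (\<lambda>z. z \<in> {..<0}) (nhds y)"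
    using less by (intro eventually_nhds_in_open) auto
  ultimately show ?thesis
    using less by (subst DERIV_cong_ev[OF refl _ refl, where g = "\<lambda>_. 0"])
      (auto simp: flat_def elim!: eventually_mono)
next
  case greater
  have "((\<lambda>y. y powi m * exp (- 1 / y)) has_real_derivative
      (of_int m * y powi (m - 1) * exp (- 1 / y) + y powi m * (exp (- 1 / y) * (1 / y\<^sup>2)))) (at y)"
    using greater by (auto intro!: derivative_eq_intros simp: power2_eq_square)
  moreover have "y powi m * (1 / y\<^sup>2) = y powi (m - 2)"
    using greater by (simp add: power_int_diff)
  ultimately have "((\<lambda>y. y powi m * exp (- 1 / y)) has_real_derivative
      (of_int m * flat (m - 1) y + flat (m - 2) y)) (at y)"
    using greater by (simp add: flat_def mult.commute mult.left_commute mult.assoc flip: \<open>_ = y powi (m - 2)\<close>)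
  moreover have "eventually (\<lambda>z. z \<in> {0<..}) (nhds y)"
    using greater by (intro eventually_nhds_in_open) auto
  ultimately show ?thesis
    using greater by (subst DERIV_cong_ev[OF refl _ refl, where g = "\<lambda>y. y powi m * exp (- 1 / y)"])
      (auto simp: flat_def elim!: eventually_mono)
next
  case equal
  \<comment> \<open>At the origin the difference quotient of \<open>flat m\<close> from the right is \<open>flat (m - 1)\<close>, which tends to 0.\<close>
  have "((\<lambda>h::real. h powr real_of_int (m - 1) * exp (- 1 / h)) \<longlongrightarrow> 0) (at_right 0)"
    by real_asymp
  moreover have "eventually (\<lambda>h::real. h \<in> {0<..<1}) (at_right 0)"
    by (rule eventually_at_right_real) simp
  ultimately have "((\<lambda>h. (flat m (0 + h) - flat m 0) / h) \<longlongrightarrow> 0) (at_right 0)"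
    by (rule Lim_transform_eventually[OF _ eventually_mono])
      (auto simp: flat_def powr_real_of_int' power_int_diff powr_diff)
  moreover have "((\<lambda>h. (flat m (0 + h) - flat m 0) / h) \<longlongrightarrow> 0) (at_left 0)"
    by (rule Lim_transform_eventually[OF tendsto_const]) (auto simp: flat_def eventually_at_filter)
  ultimately have "(flat m has_real_derivative 0) (at 0)"
    unfolding DERIV_def by (simp add: filterlim_split_at)
  then show ?thesis using equal by (simp add: flat_def)
qed

lemma flat_wave_C_on:
  fixes S :: "(real \<times> (real ^ 3)) set"
  assumes "approachable S"
  shows "C_on j S (\<lambda>(t, x). (flat m (n * (c - t)) * wave k a x) *\<^sub>R e)"
proof (induction j arbitrary: m a)
  case 0
  have "continuous_on UNIV (flat m)"
    by (meson DERIV_isCont continuous_at_imp_continuous_on flat_has_real_derivative)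
  then show ?case
    unfolding C_on.simps case_prod_beta
    by (auto intro!: continuous_intros continuous_on_compose2[of UNIV "flat m"]
        continuous_on_compose2[OF continuous_on_wave[of UNIV]])
next
  case (Suc j)
  let ?D = "\<lambda>p v. (fst v * (- n) * of_int m) *\<^sub>R (flat (m - 1) (n * (c - fst p)) * wave k a (snd p)) *\<^sub>R e
    + (fst v * (- n)) *\<^sub>R (flat (m - 2) (n * (c - fst p)) * wave k a (snd p)) *\<^sub>R e
    + (2 * pi * (k \<bullet> snd v)) *\<^sub>R (flat m (n * (c - fst p)) * wave k (a + pi/2) (snd p)) *\<^sub>R e"
  show ?case
  proof (rule C_on_SucI[OF assms])
    fix p :: "real \<times> (real ^ 3)"
    have 1: "((\<lambda>p. flat m (n * (c - fst p))) has_derivative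
       (\<lambda>v. (of_int m * flat (m - 1) (n * (c - fst p)) + flat (m - 2) (n * (c - fst p))) * (- n * fst v))) (at p within S)"
      by (rule has_derivative_compose[of "\<lambda>p. n * (c - fst p)",
            OF _ flat_has_real_derivative[unfolded has_field_derivative_def]])
        (auto intro!: derivative_eq_intros)
    have 2: "((\<lambda>p. wave k a (snd p)) has_derivative (\<lambda>v. 2 * pi * (k \<bullet> snd v) * wave k (a + pi/2) (snd p))) (at p within S)"
      by (rule has_derivative_compose[of snd, OF _ wave_has_derivative])
        (auto intro!: derivative_eq_intros)
    show "((\<lambda>(t, x). (flat m (n * (c - t)) * wave k a x) *\<^sub>R e) has_derivative ?D p) (at p within S)"
      unfolding case_prod_beta
      by (rule has_derivative_eq_rhs[OF has_derivative_scaleR_left[OF has_derivative_mult[OF 1 2]]])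
        (auto simp: algebra_simps)
  next
    fix v :: "real \<times> (real ^ 3)"
    show "C_on j S (\<lambda>p. ?D p v)"
      using Suc[of "m - 1" a] Suc[of "m - 2" a] Suc[of m "a + pi/2"]
      unfolding case_prod_beta
      by (intro C_on_add C_on_scaleR assms)
  qed
qed

section \<open>The divergence theorem on the torus\<close>

text \<open>
  Cutting the shifted cube along the face $x_i = 1$ and moving the part beyond it back by one
  period reassembles the unit cube.
\<close>

lemma integral_torus_translate:
  fixes f :: "real ^ 3 \<Rightarrow> real"
  assumes per: "periodic f" and cont: "continuous_on UNIV f" and s: "0 \<le> s" "s \<le> 1"
  shows "integral (cbox 0 One) (\<lambda>x. f (x + s *\<^sub>R axis i 1)) = integral (cbox 0 One) f"
proof -
  let ?e = "axis i 1 :: real ^ 3"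
  have e: "?e \<in> Basis" by (simp add: axis_in_Basis_iff)
  have int: "f integrable_on cbox a b" for a b
    by (rule integrable_continuous) (rule continuous_on_subset[OF cont subset_UNIV])
  have "integral (cbox 0 One) (\<lambda>x. f (x + s *\<^sub>R ?e)) = integral (cbox (s *\<^sub>R ?e) (One + s *\<^sub>R ?e)) f"
    using integral_shift_cbox[of "s *\<^sub>R ?e" "s *\<^sub>R ?e" "One + s *\<^sub>R ?e" f] by simp
  also have "\<dots> = integral (cbox (s *\<^sub>R ?e) (One + s *\<^sub>R ?e) \<inter> {x. x \<bullet> ?e \<le> 1}) f
      + integral (cbox (s *\<^sub>R ?e) (One + s *\<^sub>R ?e) \<inter> {x. x \<bullet> ?e \<ge> 1}) f"
    by (rule integral_split[OF int e])
  also have "cbox (s *\<^sub>R ?e) (One + s *\<^sub>R ?e) \<inter> {x. x \<bullet> ?e \<le> 1} = cbox 0 One \<inter> {x. x \<bullet> ?e \<ge> s}"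
    by (rule set_eqI, use exhaust_3[of i] s in \<open>auto simp: mem_box_cart forall_3 axis_1_nth inner_axis One_nth simp del: sum_component\<close>)
  also have "cbox (s *\<^sub>R ?e) (One + s *\<^sub>R ?e) \<inter> {x. x \<bullet> ?e \<ge> 1} = cbox ?e (One + s *\<^sub>R ?e)"
    by (rule set_eqI, use exhaust_3[of i] s in \<open>auto simp: mem_box_cart forall_3 axis_1_nth inner_axis One_nth simp del: sum_component\<close>)
  also have "integral (cbox ?e (One + s *\<^sub>R ?e)) f = integral (cbox 0 (One + s *\<^sub>R ?e - ?e)) (\<lambda>x. f (x + ?e))"
    using integral_shift_cbox[of ?e ?e "One + s *\<^sub>R ?e" f] by simp
  also have "(\<lambda>x. f (x + ?e)) = f"
    using per by (auto simp: periodic_def axis_def)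
  also have "cbox 0 (One + s *\<^sub>R ?e - ?e) = cbox 0 One \<inter> {x. x \<bullet> ?e \<le> s}"
    by (rule set_eqI, use exhaust_3[of i] s in \<open>auto simp: mem_box_cart forall_3 axis_1_nth inner_axis One_nth simp del: sum_component\<close>)
  also have "integral (cbox 0 One \<inter> {x. x \<bullet> ?e \<ge> s}) f + integral (cbox 0 One \<inter> {x. x \<bullet> ?e \<le> s}) f
      = integral (cbox 0 One) f"
    using integral_split[OF int e, of 0 One s] by simp
  finally show ?thesis .
qed

text \<open>
  The mean of $f(\cdot + s e_i)$ does not depend on $s$; differentiate it at $s = 0$.
\<close>

lemma integral_torus_partial_eq_0:
  fixes f :: "real ^ 3 \<Rightarrow> real"
  assumes per: "periodic f" and der: "\<And>x. (f has_derivative f' x) (at x)"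
    and cont: "continuous_on UNIV (\<lambda>x. f' x (axis i 1))"
  shows "integral (cbox 0 One) (\<lambda>x. f' x (axis i 1)) = 0"
proof -
  let ?e = "axis i 1 :: real ^ 3"
  have cf: "continuous_on UNIV f"
    using der by (meson continuous_at_imp_continuous_on has_derivative_continuous)
  have "((\<lambda>s. integral (cbox 0 One) (\<lambda>x. f (x + s *\<^sub>R ?e))) has_vector_derivative
      integral (cbox 0 One) (\<lambda>x. f' (x + 0 *\<^sub>R ?e) ?e)) (at 0 within {0..1})"
  proof (rule leibniz_rule_vector_derivative)
    fix s :: real and x :: "real ^ 3"
    have "((\<lambda>s. x + s *\<^sub>R ?e) has_vector_derivative ?e) (at s within {0..1})"
      by (auto intro!: derivative_eq_intros)
    from vector_derivative_diff_chain_within[OF this, of f "f' (x + s *\<^sub>R ?e)"] der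
    show "((\<lambda>s. f (x + s *\<^sub>R ?e)) has_vector_derivative f' (x + s *\<^sub>R ?e) ?e) (at s within {0..1})"
      by (simp add: o_def has_derivative_at_withinI)
  next
    fix s :: real
    show "(\<lambda>x. f (x + s *\<^sub>R ?e)) integrable_on cbox 0 One"
      by (intro integrable_continuous continuous_on_compose2[OF cf]) (auto intro!: continuous_intros)
  next
    show "continuous_on ({0..1} \<times> cbox 0 One) (\<lambda>(s, x). f' (x + s *\<^sub>R ?e) ?e)"
      unfolding case_prod_beta
      by (intro continuous_on_compose2[OF cont]) (auto intro!: continuous_intros)
  qed auto
  moreover have "((\<lambda>s. integral (cbox 0 One) (\<lambda>x. f (x + s *\<^sub>R ?e))) has_vector_derivative 0) (at 0 within {0..1})"
  proof (rule has_vector_derivative_transform)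
    show "((\<lambda>s. integral (cbox 0 One) f) has_vector_derivative 0) (at 0 within {0..1})"
      by simp
  qed (auto simp: integral_torus_translate[OF per cf])
  ultimately show ?thesis
    using vector_derivative_unique_within[of 0 "{0..1::real}"] by (simp add: trivial_limit_within islimpt_Icc)
qed

lemma integral_torus_divergence_eq_0:
  fixes G :: "real ^ 3 \<Rightarrow> real ^ 3"
  assumes per: "periodic G" and der: "\<And>x. (G has_derivative G' x) (at x)"
    and cont: "\<And>v. continuous_on UNIV (\<lambda>x. G' x v)"
  shows "integral (cbox 0 One) (\<lambda>x. \<Sum>i\<in>UNIV. G' x (axis i 1) $ i) = 0"
proof -
  have c: "continuous_on A (\<lambda>x. G' x (axis i 1) $ i)" for i A
    by (intro continuous_intros continuous_on_subset[OF cont]) auto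
  have "integral (cbox 0 One) (\<lambda>x. G' x (axis i 1) $ i) = 0" for i
  proof (rule integral_torus_partial_eq_0[of "\<lambda>x. G x $ i" "\<lambda>x v. G' x v $ i"])
    show "periodic (\<lambda>x. G x $ i)" using per by (simp add: periodic_def)
    show "((\<lambda>x. G x $ i) has_derivative (\<lambda>v. G' x v $ i)) (at x)" for x
      using bounded_linear.has_derivative[OF bounded_linear_vec_nth der] .
  qed (rule c)
  then show ?thesis
    by (subst integral_sum) (auto intro!: integrable_continuous c)
qed

section \<open>Completeness of the trigonometric system\<close>

lemma space_torus: "space torus = cbox 0 One"
  by (simp add: torus_def)

lemma finite_measure_torus: "finite_measure torus"
  unfolding torus_def
  by (rule finite_measure_lebesgue_on) auto

lemma integrable_torus_const: "integrable torus (\<lambda>x. c :: 'b :: euclidean_space)"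
  using finite_measure.integrable_const[OF finite_measure_torus] .

lemma measure_torus: "measure torus (space torus) = 1"
  by (simp add: torus_def measure_restrict_space content_unit)

lemma integrable_torus_continuous:
  fixes f :: "real ^ 3 \<Rightarrow> 'b::euclidean_space"
  assumes "continuous_on UNIV f"
  shows "integrable torus f"
  unfolding torus_def
  by (rule continuous_imp_integrable) (rule continuous_on_subset[OF assms subset_UNIV])

lemma integral_torus_continuous:
  fixes f :: "real ^ 3 \<Rightarrow> 'b::euclidean_space"
  assumes "continuous_on UNIV f"
  shows "(LINT x|torus. f x) = integral (cbox 0 One) f"
  using integrable_torus_continuous[OF assms] unfolding torus_def
  by (rule lebesgue_integral_eq_integral) simp

text \<open>
  Square integrability over the unit cube, without the periodicity that \<open>L2\<close> includes.
\<close>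

definition square_int :: "(real ^ 3 \<Rightarrow> 'b::euclidean_space) \<Rightarrow> bool" where
  "square_int f \<longleftrightarrow> f \<in> borel_measurable torus \<and> integrable torus (\<lambda>x. (norm (f x))\<^sup>2)"

lemma L2_imp_square_int: "f \<in> L2 \<Longrightarrow> square_int f"
  unfolding square_int_def L2_def by (auto simp: torus_def measurable_restrict_space1)

lemma square_int_continuous: "continuous_on UNIV f \<Longrightarrow> square_int f"
  unfolding square_int_def
  by (auto intro!: borel_measurable_integrable integrable_torus_continuous continuous_intros)

lemma square_int_scaleR: "square_int f \<Longrightarrow> square_int (\<lambda>x. c *\<^sub>R f x)"
  unfolding square_int_def by (auto simp: power_mult_distrib)

lemma square_int_add:
  assumes "square_int f" "square_int g" shows "square_int (\<lambda>x. f x + g x)"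
  unfolding square_int_def
proof
  show m: "(\<lambda>x. f x + g x) \<in> borel_measurable torus"
    using assms by (auto simp: square_int_def)
  show "integrable torus (\<lambda>x. (norm (f x + g x))\<^sup>2)"
  proof (rule Bochner_Integration.integrable_bound)
    show "integrable torus (\<lambda>x. 2 * (norm (f x))\<^sup>2 + 2 * (norm (g x))\<^sup>2)"
      using assms by (auto simp: square_int_def)
    have "(norm (f x + g x))\<^sup>2 \<le> 2 * (norm (f x))\<^sup>2 + 2 * (norm (g x))\<^sup>2" for x
    proof -
      have "(norm (f x + g x))\<^sup>2 \<le> (norm (f x) + norm (g x))\<^sup>2"
        by (intro power_mono norm_triangle_ineq) auto
      also have "\<dots> \<le> 2 * (norm (f x))\<^sup>2 + 2 * (norm (g x))\<^sup>2"
        using zero_le_power2[of "norm (f x) - norm (g x)"]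
        by (simp add: power2_sum power2_diff)
      finally show ?thesis .
    qed
    then show "AE x in torus. norm ((norm (f x + g x))\<^sup>2) \<le> norm (2 * (norm (f x))\<^sup>2 + 2 * (norm (g x))\<^sup>2)"
      by simp
  qed (use m in measurable)
qed

lemma square_int_diff:
  assumes "square_int f" "square_int g" shows "square_int (\<lambda>x. f x - g x)"
  using square_int_add[OF assms(1) square_int_scaleR[OF assms(2), of "-1"]] by simp

lemma integrable_square_int_inner:
  assumes "square_int f" "square_int g" shows "integrable torus (\<lambda>x. f x \<bullet> g x)"
proof (rule Bochner_Integration.integrable_bound)
  show "integrable torus (\<lambda>x. (norm (f x))\<^sup>2 + (norm (g x))\<^sup>2)"
    using assms by (auto simp: square_int_def)
  have "norm (f x \<bullet> g x) \<le> (norm (f x))\<^sup>2 + (norm (g x))\<^sup>2" for x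
  proof -
    have "norm (f x \<bullet> g x) \<le> norm (f x) * norm (g x)"
      using Cauchy_Schwarz_ineq2 by simp
    also have "\<dots> \<le> (norm (f x))\<^sup>2 + (norm (g x))\<^sup>2"
      using zero_le_power2[of "norm (f x) - norm (g x)"] mult_nonneg_nonneg[OF norm_ge_zero[of "f x"] norm_ge_zero[of "g x"]]
      unfolding power2_diff by linarith
    finally show ?thesis .
  qed
  then show "AE x in torus. norm (f x \<bullet> g x) \<le> norm ((norm (f x))\<^sup>2 + (norm (g x))\<^sup>2)"
    by simp
qed (use assms in \<open>auto simp: square_int_def\<close>)

lemma square_int_imp_integrable:
  assumes "square_int f" shows "integrable torus f"
proof (rule Bochner_Integration.integrable_bound)
  show "integrable torus (\<lambda>x. (norm (f x))\<^sup>2 + 1)"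
    using assms by (intro Bochner_Integration.integrable_add integrable_torus_const) (simp add: square_int_def)
  have "norm (f x) \<le> (norm (f x))\<^sup>2 + 1" for x
    using zero_le_power2[of "norm (f x) - 1/2"] unfolding power2_diff
    by (simp add: power_divide)
  then show "AE x in torus. norm (f x) \<le> norm ((norm (f x))\<^sup>2 + 1)"
    by (simp add: order_trans)
qed (use assms in \<open>auto simp: square_int_def\<close>)

lemma L2_norm_power2: "(L2_norm f)\<^sup>2 = (LINT x|torus. (norm (f x))\<^sup>2)"
  by (simp add: L2_norm_def L2_inner_def power2_norm_eq_inner)

lemma L2_norm_nonneg: "L2_norm f \<ge> 0"
  by (simp add: L2_norm_def L2_inner_def)

text \<open>
  Real trigonometric polynomials, as finite sums of multiples of waves.
\<close>

inductive trig_poly :: "(real ^ 3 \<Rightarrow> real) \<Rightarrow> bool" where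
  trig_poly_wave: "k \<in> freq \<Longrightarrow> trig_poly (\<lambda>x. c * wave k a x)"
| trig_poly_add: "trig_poly f \<Longrightarrow> trig_poly g \<Longrightarrow> trig_poly (\<lambda>x. f x + g x)"

lemma freq_add: "k \<in> freq \<Longrightarrow> m \<in> freq \<Longrightarrow> k + m \<in> freq"
  and freq_diff: "k \<in> freq \<Longrightarrow> m \<in> freq \<Longrightarrow> k - m \<in> freq"
  and freq_uminus: "k \<in> freq \<Longrightarrow> - k \<in> freq"
  and freq_0: "0 \<in> freq"
  and freq_axis: "axis i 1 \<in> freq"
  by (auto simp: freq_def axis_def)

lemma wave_mult:
  "wave k a x * wave m b x = (wave (k - m) (a - b) x + wave (k + m) (a + b) x) / 2"
  unfolding wave_def cos_times_cos by (simp add: algebra_simps)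

lemma trig_poly_mult_wave:
  assumes "trig_poly f" "k \<in> freq" shows "trig_poly (\<lambda>x. f x * (c * wave k a x))"
  using assms(1)
proof induction
  case (trig_poly_wave m d b)
  have "(\<lambda>x. d * wave m b x * (c * wave k a x)) =
    (\<lambda>x. (c * d / 2) * wave (m - k) (b - a) x + (c * d / 2) * wave (m + k) (b + a) x)"
  proof
    fix x
    have "d * wave m b x * (c * wave k a x) = c * d * (wave m b x * wave k a x)" by (simp add: algebra_simps)
    also have "\<dots> = (c * d / 2) * wave (m - k) (b - a) x + (c * d / 2) * wave (m + k) (b + a) x"
      unfolding wave_mult by (simp add: algebra_simps)
    finally show "d * wave m b x * (c * wave k a x) =
      (c * d / 2) * wave (m - k) (b - a) x + (c * d / 2) * wave (m + k) (b + a) x" .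
  qed
  moreover have "trig_poly (\<lambda>x. (c * d / 2) * wave (m - k) (b - a) x + (c * d / 2) * wave (m + k) (b + a) x)"
    by (intro trig_poly.intros freq_add freq_diff assms trig_poly_wave)
  ultimately show ?case by (simp only:)
next
  case (trig_poly_add f g)
  then show ?case
    using trig_poly.trig_poly_add[OF trig_poly_add.IH] by (simp add: algebra_simps)
qed

lemma trig_poly_mult:
  assumes "trig_poly f" "trig_poly g" shows "trig_poly (\<lambda>x. f x * g x)"
  using assms(2)
proof induction
  case (trig_poly_wave k c a)
  then show ?case using trig_poly_mult_wave[OF assms(1)] by blast
next
  case (trig_poly_add g h)
  then show ?case
    using trig_poly.trig_poly_add[OF trig_poly_add.IH] by (simp add: algebra_simps)
qed

lemma trig_poly_const: "trig_poly (\<lambda>x. c)"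
  using trig_poly_wave[OF freq_0, of c 0] by (simp add: wave_def)

lemma continuous_on_trig_poly: "trig_poly f \<Longrightarrow> continuous_on S f"
  by (induction rule: trig_poly.induct) (auto intro!: continuous_intros)

text \<open>
  Stone--Weierstrass on the torus, realised as the image $S$ of the cube under the embedding
  $E(x) = (\cos 2\pi x_i, \sin 2\pi x_i)_i$. A continuous periodic function factors through $E$;
  the factor is continuous on $S$ because the cube is compact.
\<close>

lemma trig_poly_dense:
  assumes cont: "continuous_on UNIV g" and per: "periodic g" and e: "e > 0"
  obtains q where "trig_poly q" "\<And>x. x \<in> cbox 0 One \<Longrightarrow> \<bar>g x - q x\<bar> < e"
proof -
  define E :: "real ^ 3 \<Rightarrow> (real ^ 3) \<times> (real ^ 3)" where
    "E = (\<lambda>x. (\<chi> i. cos (2 * pi * x $ i), \<chi> i. sin (2 * pi * x $ i)))"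
  let ?Q = "cbox 0 One :: (real ^ 3) set"
  define S where "S = E ` ?Q"
  define h where "h = (\<lambda>z. g (inv_into ?Q E z))"
  have contE: "continuous_on A E" for A
    unfolding E_def by (intro continuous_intros continuous_on_vec_lambda)
  have compS: "compact S"
    unfolding S_def by (rule compact_continuous_image[OF contE]) simp
  have E_eq: "g x = g y" if "E x = E y" for x y
  proof -
    have "\<exists>n::int. x $ i = y $ i + n" for i
    proof -
      have "cos (2 * pi * x $ i) = cos (2 * pi * y $ i)" "sin (2 * pi * x $ i) = sin (2 * pi * y $ i)"
        using that by (auto simp: E_def vec_eq_iff)
      then obtain n :: int where "2 * pi * x $ i = 2 * pi * y $ i + 2 * pi * n"
        using sin_cos_eq_iff by metis
      then have "2 * pi * x $ i = 2 * pi * (y $ i + n)" by (simp add: algebra_simps)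
      then show ?thesis by auto
    qed
    then have "\<forall>i. (x - y) $ i \<in> \<int>" by (metis Ints_of_int add_diff_cancel_left' vector_minus_component)
    then have "g (y + (x - y)) = g y" using per unfolding periodic_def by blast
    then show ?thesis by simp
  qed
  have hE: "h (E x) = g x" if "x \<in> ?Q" for x
    unfolding h_def using that by (intro E_eq f_inv_into_f) auto
  have "closed (h -` B \<inter> S)" if "closed B" for B
  proof -
    have "h -` B \<inter> S = E ` (g -` B \<inter> ?Q)"
      unfolding S_def using hE by auto
    moreover have "compact (g -` B \<inter> ?Q)"
      using continuous_closed_vimage[OF that] cont
      by (intro closed_Int_compact) (auto simp: continuous_on_eq_continuous_at)
    ultimately show ?thesis
      by (metis compact_continuous_image compact_imp_closed contE)
  qed
  then have conth: "continuous_on S h"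
    using continuous_on_closed_vimage[OF compact_imp_closed[OF compS]] by blast
  define P where "P = (\<lambda>f. continuous_on S f \<and> trig_poly (\<lambda>x. f (E x)))"
  have Pcos: "P (\<lambda>z. fst z $ i)" and Psin: "P (\<lambda>z. snd z $ i)" for i
  proof -
    show "P (\<lambda>z. fst z $ i)"
      using trig_poly_wave[OF freq_axis[of i], of 1 0]
      by (auto simp: P_def E_def wave_def inner_axis' intro!: continuous_intros)
    show "P (\<lambda>z. snd z $ i)"
      using trig_poly_wave[OF freq_axis[of i], of 1 "-pi/2"]
      by (auto simp: P_def E_def wave_def inner_axis' cos_diff intro!: continuous_intros)
  qed
  obtain f where f: "P f" "\<forall>z\<in>S. \<bar>h z - f z\<bar> < e"
  proof (rule exE[OF Stone_Weierstrass_HOL[of S P h e, OF compS]])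
    show "P (\<lambda>x. c)" for c
      by (simp add: P_def trig_poly_const)
    show "continuous_on S f" if "P f" for f using that by (simp add: P_def)
    show "P (\<lambda>x. f x + g x)" if "P f \<and> P g" for f g
      using that by (auto simp: P_def intro!: continuous_intros trig_poly_add)
    show "P (\<lambda>x. f x * g x)" if "P f \<and> P g" for f g
      using that by (auto simp: P_def intro!: continuous_intros trig_poly_mult)
    show "\<exists>f. P f \<and> f x \<noteq> f y" if "x \<in> S \<and> y \<in> S \<and> x \<noteq> y" for x y
    proof -
      obtain i where "fst x $ i \<noteq> fst y $ i \<or> snd x $ i \<noteq> snd y $ i"
        using \<open>x \<in> S \<and> y \<in> S \<and> x \<noteq> y\<close> by (auto simp: prod_eq_iff vec_eq_iff)
      then show ?thesis using Pcos[of i] Psin[of i] by blast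
    qed
  qed (use conth e in auto)
  show thesis
  proof (rule that)
    show "trig_poly (\<lambda>x. f (E x))" using f by (simp add: P_def)
    show "\<bar>g x - f (E x)\<bar> < e" if "x \<in> ?Q" for x
      using f(2) hE[OF that] that by (auto simp: S_def)
  qed
qed

text \<open>
  \<open>f\<close> is a limit in $L^2$ of continuous periodic fields. For the fields considered here this is
  immediate from the definition of \<open>H_space\<close> as a closure.
\<close>

definition continuous_approx :: "(real ^ 3 \<Rightarrow> real ^ 3) \<Rightarrow> bool" where
  "continuous_approx f \<longleftrightarrow>
     (\<forall>e>0. \<exists>g. continuous_on UNIV g \<and> periodic g \<and> L2_norm (\<lambda>x. f x - g x) < e)"

lemma trig_poly_orthogonal:
  assumes f: "square_int f" and orth: "\<And>k a. k \<in> freq \<Longrightarrow> (LINT x|torus. f x \<bullet> (wave k a x *\<^sub>R e)) = 0"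
    and q: "trig_poly q"
  shows "(LINT x|torus. f x \<bullet> (q x *\<^sub>R e)) = 0"
  using q
proof induction
  case (trig_poly_wave k c a)
  have "(\<lambda>x. f x \<bullet> ((c * wave k a x) *\<^sub>R e)) = (\<lambda>x. c * (f x \<bullet> (wave k a x *\<^sub>R e)))"
    by (simp add: mult.assoc)
  then show ?case using orth[OF trig_poly_wave, of a] by simp
next
  case (trig_poly_add p q)
  have int: "integrable torus (\<lambda>x. f x \<bullet> (r x *\<^sub>R e))" if "trig_poly r" for r
    by (rule integrable_square_int_inner[OF f square_int_continuous])
      (intro continuous_on_scaleR continuous_on_const continuous_on_trig_poly that)
  have "(LINT x|torus. f x \<bullet> ((p x + q x) *\<^sub>R e))
      = (LINT x|torus. f x \<bullet> (p x *\<^sub>R e) + f x \<bullet> (q x *\<^sub>R e))"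
    by (simp only: scaleR_add_left inner_add_right)
  also have "\<dots> = 0"
    using int trig_poly_add by simp
  finally show ?case .
qed

text \<open>
  Completeness of the trigonometric system. If $f$ is orthogonal to all trigonometric polynomials
  $Q$, then $\|f\|^2 \le \|f - Q\|^2$ for every $Q$, and the right-hand side can be made small.
\<close>

lemma AE_eq_0_if_orthogonal_to_waves:
  assumes f: "square_int f" and appr: "continuous_approx f"
    and orth: "\<And>k a i. k \<in> freq \<Longrightarrow> (LINT x|torus. f x \<bullet> (wave k a x *\<^sub>R axis i 1)) = 0"
  shows "AE x in torus. f x = 0"
proof -
  define N where "N = (LINT x|torus. (norm (f x))\<^sup>2)"
  have small: "N \<le> 8 * e\<^sup>2" if e: "e > 0" for e
  proof -
    obtain g where g: "continuous_on UNIV g" "periodic g" "L2_norm (\<lambda>x. f x - g x) < e"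
      using appr e unfolding continuous_approx_def by blast
    have "\<exists>q. trig_poly q \<and> (\<forall>x\<in>cbox 0 One. \<bar>g x $ i - q x\<bar> < e)" for i
    proof -
      have "continuous_on UNIV (\<lambda>x. g x $ i)" using g(1) by (rule continuous_on_component)
      moreover have "periodic (\<lambda>x. g x $ i)" using g(2) by (simp add: periodic_def)
      ultimately show ?thesis using e by (rule trig_poly_dense) blast
    qed
    then have "\<forall>i. \<exists>q. trig_poly q \<and> (\<forall>x\<in>cbox 0 One. \<bar>g x $ i - q x\<bar> < e)" by (rule allI)
    then have "\<exists>q. \<forall>i. trig_poly (q i) \<and> (\<forall>x\<in>cbox 0 One. \<bar>g x $ i - q i x\<bar> < e)"
      by (rule choice)
    then obtain q where q: "\<And>i. trig_poly (q i)" "\<And>i x. x \<in> cbox 0 One \<Longrightarrow> \<bar>g x $ i - q i x\<bar> < e"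
      by blast
    define Q where "Q = (\<lambda>x. \<Sum>i\<in>UNIV. q i x *\<^sub>R axis i (1::real))"
    have Qi: "Q x $ i = q i x" for x i
    proof -
      have "Q x $ i = (\<Sum>j\<in>UNIV. if j = i then q j x else 0)"
        unfolding Q_def sum_component by (intro sum.cong) (auto simp: axis_def)
      then show ?thesis by simp
    qed
    have cQ: "continuous_on UNIV Q"
      unfolding Q_def by (intro continuous_on_sum continuous_on_scaleR continuous_on_const continuous_on_trig_poly q)
    have "(LINT x|torus. f x \<bullet> Q x) = (\<Sum>i\<in>UNIV. LINT x|torus. f x \<bullet> (q i x *\<^sub>R axis i 1))"
      unfolding Q_def inner_sum_right
      by (rule Bochner_Integration.integral_sum, rule integrable_square_int_inner[OF f])
        (intro square_int_continuous continuous_on_scaleR continuous_on_const continuous_on_trig_poly q)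
    also have "\<dots> = 0"
      by (intro sum.neutral ballI) (rule trig_poly_orthogonal[OF f orth q(1)])
    finally have "(LINT x|torus. f x \<bullet> Q x) = 0" .
    moreover have ints: "integrable torus (\<lambda>x. (norm (f x))\<^sup>2)" "integrable torus (\<lambda>x. f x \<bullet> Q x)"
        "integrable torus (\<lambda>x. (norm (f x - Q x))\<^sup>2)" "integrable torus (\<lambda>x. (norm (f x - g x))\<^sup>2)"
      using f integrable_square_int_inner[OF f square_int_continuous[OF cQ]]
        square_int_diff[OF f square_int_continuous[OF cQ]]
        square_int_diff[OF f square_int_continuous[OF g(1)]] by (simp_all add: square_int_def)
    ultimately have "N = (LINT x|torus. (norm (f x))\<^sup>2 - 2 * (f x \<bullet> Q x))"
      by (simp add: N_def)
    also have "\<dots> \<le> (LINT x|torus. (norm (f x - Q x))\<^sup>2)"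
      using ints by (intro integral_mono) (auto simp: power2_norm_eq_inner inner_diff inner_commute[of "Q _" "f _"])
    also have "\<dots> \<le> (LINT x|torus. 2 * (norm (f x - g x))\<^sup>2 + 6 * e\<^sup>2)"
    proof (intro integral_mono ints)
      show "integrable torus (\<lambda>x. 2 * (norm (f x - g x))\<^sup>2 + 6 * e\<^sup>2)"
        by (intro Bochner_Integration.integrable_add integrable_torus_const integrable_mult_right ints)
      fix x assume "x \<in> space torus"
      then have x: "x \<in> cbox 0 One" by (simp add: space_torus)
      have "(norm (g x - Q x))\<^sup>2 = (\<Sum>i\<in>UNIV. (g x $ i - q i x)\<^sup>2)"
        by (simp add: norm_vec_def L2_set_def Qi sum_nonneg)
      also have "\<dots> \<le> (\<Sum>i\<in>(UNIV::3 set). e\<^sup>2)"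
      proof (rule sum_mono)
        fix i
        have "\<bar>g x $ i - q i x\<bar> \<le> \<bar>e\<bar>" using q(2)[OF x, of i] e by linarith
        then show "(g x $ i - q i x)\<^sup>2 \<le> e\<^sup>2" by (simp only: abs_le_square_iff)
      qed
      finally have 1: "(norm (g x - Q x))\<^sup>2 \<le> 3 * e\<^sup>2" by simp
      have "norm (f x - Q x) \<le> norm (f x - g x) + norm (g x - Q x)"
        using norm_triangle_ineq[of "f x - g x" "g x - Q x"] by simp
      then have "(norm (f x - Q x))\<^sup>2 \<le> (norm (f x - g x) + norm (g x - Q x))\<^sup>2"
        by (intro power_mono) auto
      also have "\<dots> \<le> 2 * (norm (f x - g x))\<^sup>2 + 2 * (norm (g x - Q x))\<^sup>2"
        using zero_le_power2[of "norm (f x - g x) - norm (g x - Q x)"]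
        by (simp add: power2_sum power2_diff)
      finally show "(norm (f x - Q x))\<^sup>2 \<le> 2 * (norm (f x - g x))\<^sup>2 + 6 * e\<^sup>2"
        using 1 by simp
    qed
    also have "\<dots> = 2 * (L2_norm (\<lambda>x. f x - g x))\<^sup>2 + 6 * e\<^sup>2"
      using ints integrable_torus_const[of "6 * e\<^sup>2"] measure_torus
      by (simp add: L2_norm_power2)
    also have "\<dots> \<le> 2 * e\<^sup>2 + 6 * e\<^sup>2"
      using power_mono[OF less_imp_le[OF g(3)] L2_norm_nonneg, of 2] by simp
    finally show "N \<le> 8 * e\<^sup>2" by simp
  qed
  \<comment> \<open>With \<open>e\<close> such that \<open>8 * e\<^sup>2\<close> is half of \<open>N\<close>, the bound contradicts positivity of \<open>N\<close>.\<close>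
  have "N \<le> 0"
  proof (rule ccontr)
    assume "\<not> N \<le> 0"
    then have "N \<le> 8 * (sqrt (N / 16))\<^sup>2" by (intro small) simp
    also have "\<dots> = N / 2" using \<open>\<not> N \<le> 0\<close> by simp
    finally show False using \<open>\<not> N \<le> 0\<close> by linarith
  qed
  moreover have "N \<ge> 0" unfolding N_def by simp
  ultimately have "N = 0" by simp
  moreover have "N = 0 \<longleftrightarrow> (AE x in torus. (norm (f x))\<^sup>2 = 0)"
    unfolding N_def using f by (intro integral_nonneg_eq_0_iff_AE) (simp_all add: square_int_def)
  ultimately have "AE x in torus. (norm (f x))\<^sup>2 = 0" by blast
  then show ?thesis by simp
qed

section \<open>Fourier coefficients of Beltrami fields\<close>

lemma partial_eq: "(f has_derivative f') (at x) \<Longrightarrow> partial i f x = f' (axis i 1)"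
  unfolding partial_def by (simp add: frechet_derivative_at[symmetric])

lemma Jac_eq: "(f has_derivative f') (at x) \<Longrightarrow> Jac f x $ i $ j = f' (axis j 1) $ i"
  unfolding Jac_def jacobian_def by (simp add: frechet_derivative_at[symmetric] matrix_def)

lemma div_field_eq: "(f has_derivative f') (at x) \<Longrightarrow> div_field f x = (\<Sum>i\<in>UNIV. f' (axis i 1) $ i)"
  unfolding div_field_def trace_def by (simp add: Jac_eq)

text \<open>
  The curl as a function of the derivative at the point.
\<close>

definition curl_of :: "(real ^ 3 \<Rightarrow> real ^ 3) \<Rightarrow> real ^ 3" where
  "curl_of L = vector
     [L (axis 2 1) $ 3 - L (axis 3 1) $ 2,
      L (axis 3 1) $ 1 - L (axis 1 1) $ 3,
      L (axis 1 1) $ 2 - L (axis 2 1) $ 1]"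

lemma curl_eq: "(f has_derivative f') (at x) \<Longrightarrow> curl f x = curl_of f'"
  unfolding curl_def curl_of_def by (simp add: partial_eq)

lemma curl_of_sum: "curl_of (\<lambda>v. \<Sum>i\<in>I. L i v) = (\<Sum>i\<in>I. curl_of (L i))"
  by (simp add: vec_eq_iff forall_3 curl_of_def sum_subtractf)

lemma curl_of_plane: "curl_of (\<lambda>v. (c * (k \<bullet> v)) *\<^sub>R w) = c *\<^sub>R cross3 k w"
  by (simp add: vec_eq_iff forall_3 curl_of_def cross3_def inner_axis algebra_simps)

lemma smooth_torus_has_derivative:
  assumes "g \<in> smooth_torus"
  shows "(g has_derivative frechet_derivative g (at x)) (at x)"
  using assms C_on_has_derivative[of 0 UNIV g x] unfolding smooth_torus_def smooth_on_def by blast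

lemma smooth_torus_continuous:
  assumes "g \<in> smooth_torus" shows "continuous_on UNIV g"
  using assms C_on.simps(1) unfolding smooth_torus_def smooth_on_def by blast

lemma smooth_torus_continuous_derivative:
  assumes "g \<in> smooth_torus" shows "continuous_on UNIV (\<lambda>x. frechet_derivative g (at x) v)"
proof -
  have "C_on (Suc 0) UNIV g" using assms unfolding smooth_torus_def smooth_on_def by blast
  then show ?thesis by simp
qed

lemma wave_smooth_torus: "k \<in> freq \<Longrightarrow> (\<lambda>x. wave k a x *\<^sub>R c) \<in> smooth_torus"
  using periodic_wave[of k a] by (auto simp: smooth_torus_def smooth_on_def wave_C_on periodic_def)

lemma sum_smooth_torus:
  assumes "\<And>i. i \<in> I \<Longrightarrow> f i \<in> smooth_torus" shows "(\<lambda>x. \<Sum>i\<in>I. f i x) \<in> smooth_torus"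
  using assms unfolding smooth_torus_def smooth_on_def
  by (auto intro!: C_on_sum simp: periodic_def)

lemma add_smooth_torus:
  assumes "f \<in> smooth_torus" "g \<in> smooth_torus" shows "(\<lambda>x. f x + g x) \<in> smooth_torus"
  using assms unfolding smooth_torus_def smooth_on_def
  by (auto intro!: C_on_add simp: periodic_def)

lemma LINT_wave:
  assumes "k \<in> freq"
  shows "(LINT x|torus. wave k a x) = (if k = 0 then cos a else 0)"
proof (cases "k = 0")
  case True
  then show ?thesis using measure_torus by (simp add: wave_def)
next
  case False
  then obtain i where i: "k $ i \<noteq> 0" by (auto simp: vec_eq_iff)
  have "integral (cbox 0 One) (\<lambda>x. 2 * pi * (k \<bullet> axis i 1) * wave k (a - pi/2 + pi/2) x) = 0"
    by (rule integral_torus_partial_eq_0[OF periodic_wave[OF assms] wave_has_derivative])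
      (intro continuous_intros)
  then have "2 * pi * (k \<bullet> axis i 1) * integral (cbox 0 One) (wave k a) = 0" by simp
  then have "integral (cbox 0 One) (wave k a) = 0" using i by (simp add: inner_axis)
  then show ?thesis using False by (simp add: integral_torus_continuous[OF continuous_on_wave])
qed

lemma LINT_wave_mult:
  assumes "k \<in> freq" "m \<in> freq"
  shows "(LINT x|torus. wave k a x * wave m b x)
    = ((if k = m then cos (a - b) else 0) + (if k = - m then cos (a + b) else 0)) / 2"
proof -
  have "(LINT x|torus. wave k a x * wave m b x)
      = ((LINT x|torus. wave (k - m) (a - b) x) + (LINT x|torus. wave (k + m) (a + b) x)) / 2"
    unfolding wave_mult
    by (simp add: integrable_torus_continuous continuous_on_wave)
  then show ?thesis
    using assms by (simp add: LINT_wave freq_add freq_diff eq_neg_iff_add_eq_0)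
qed

text \<open>
  The vector-valued real Fourier coefficient of \<open>u\<close> at frequency \<open>k\<close> with phase \<open>a\<close>.
\<close>

definition coef :: "(real ^ 3 \<Rightarrow> real ^ 3) \<Rightarrow> real ^ 3 \<Rightarrow> real \<Rightarrow> real ^ 3" where
  "coef u k a = (LINT x|torus. wave k a x *\<^sub>R u x)"

lemma integrable_wave_scaleR:
  assumes "square_int u" shows "integrable torus (\<lambda>x. wave k a x *\<^sub>R u x)"
proof (rule Bochner_Integration.integrable_bound[OF square_int_imp_integrable[OF assms]])
  show "(\<lambda>x. wave k a x *\<^sub>R u x) \<in> borel_measurable torus"
    using assms borel_measurable_integrable[OF integrable_torus_continuous[OF continuous_on_wave]]
    by (auto simp: square_int_def)
  show "AE x in torus. norm (wave k a x *\<^sub>R u x) \<le> norm (u x)"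
    by (auto simp: wave_def mult_left_le_one_le)
qed

lemma coef_inner:
  assumes "square_int u" shows "coef u k a \<bullet> e = (LINT x|torus. u x \<bullet> (wave k a x *\<^sub>R e))"
proof -
  have "(LINT x|torus. (wave k a x *\<^sub>R u x) \<bullet> e) = coef u k a \<bullet> e"
    unfolding coef_def by (intro integral_inner_left integrable_wave_scaleR assms)
  then show ?thesis by simp
qed

lemma coef_diff:
  assumes "square_int u" "square_int v"
  shows "coef (\<lambda>x. u x - v x) k a = coef u k a - coef v k a"
  unfolding coef_def using assms by (simp add: scaleR_diff_right integrable_wave_scaleR)

lemma coef_phase:
  assumes "square_int u"
  shows "coef u k a = cos a *\<^sub>R coef u k 0 + sin a *\<^sub>R coef u k (pi/2)"
proof -
  have "wave k a x *\<^sub>R u x = cos a *\<^sub>R (wave k 0 x *\<^sub>R u x) + sin a *\<^sub>R (wave k (pi/2) x *\<^sub>R u x)" for x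
    by (simp add: wave_def cos_add algebra_simps)
  then show ?thesis
    unfolding coef_def using integrable_wave_scaleR[OF assms] by (simp del: scaleR_scaleR)
qed

lemma coef_uminus: "coef u (- k) a = coef u k (- a)"
proof -
  have "wave (- k) a = wave k (- a)"
    using cos_minus[of "2 * pi * (k \<bullet> _) - a"] by (auto simp: wave_def fun_eq_iff)
  then show ?thesis by (simp add: coef_def)
qed

lemma abs_inner_le:
  fixes a b :: "'a::real_inner"
  assumes "e > 0" shows "\<bar>a \<bullet> b\<bar> \<le> (norm a)\<^sup>2 / e + e * (norm b)\<^sup>2"
proof -
  have "0 \<le> (norm a / sqrt e - sqrt e * norm b)\<^sup>2" by simp
  also have "\<dots> = (norm a)\<^sup>2 / e + e * (norm b)\<^sup>2 - 2 * (norm a * norm b)"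
    using assms by (simp add: power2_diff power_divide power_mult_distrib)
  finally have "norm a * norm b \<le> (norm a)\<^sup>2 / e + e * (norm b)\<^sup>2"
    using mult_nonneg_nonneg[OF norm_ge_zero[of a] norm_ge_zero[of b]] by linarith
  then show ?thesis using Cauchy_Schwarz_ineq2[of a b] by linarith
qed

text \<open>
  Orthogonality relations pass from the smooth solenoidal zero-mean fields to their closure.
\<close>

lemma H_space_orthogonal:
  assumes f: "f \<in> H_space" and psi: "square_int \<psi>"
    and orth: "\<And>g. \<lbrakk>g \<in> smooth_torus; \<And>x. div_field g x = 0; (LINT x|torus. g x) = 0\<rbrakk>
      \<Longrightarrow> (LINT x|torus. g x \<bullet> \<psi> x) = 0"
  shows "(LINT x|torus. f x \<bullet> \<psi> x) = 0"
proof -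
  define M where "M = (LINT x|torus. (norm (\<psi> x))\<^sup>2)"
  have sf: "square_int f" using f L2_imp_square_int by (auto simp: H_space_def)
  have M: "M \<ge> 0" by (simp add: M_def)
  have small: "\<bar>LINT x|torus. f x \<bullet> \<psi> x\<bar> \<le> e * (1 + M)" if e: "e > 0" for e
  proof -
    obtain g where g: "g \<in> smooth_torus" "\<And>x. div_field g x = 0" "(LINT x|torus. g x) = 0"
        and ge: "L2_norm (\<lambda>x. f x - g x) < e"
      using f e unfolding H_space_def by blast
    have sg: "square_int g" using smooth_torus_continuous[OF g(1)] by (rule square_int_continuous)
    have sfg: "square_int (\<lambda>x. f x - g x)" by (rule square_int_diff[OF sf sg])
    have "(LINT x|torus. f x \<bullet> \<psi> x) = (LINT x|torus. f x \<bullet> \<psi> x) - (LINT x|torus. g x \<bullet> \<psi> x)"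
      using orth[OF g] by simp
    also have "\<dots> = (LINT x|torus. (f x - g x) \<bullet> \<psi> x)"
      by (simp add: inner_diff_left integrable_square_int_inner sf sg psi)
    also have "\<bar>\<dots>\<bar> \<le> (LINT x|torus. \<bar>(f x - g x) \<bullet> \<psi> x\<bar>)"
      by (rule integral_abs_bound)
    also have "\<dots> \<le> (LINT x|torus. (norm (f x - g x))\<^sup>2 / e + e * (norm (\<psi> x))\<^sup>2)"
      using sfg psi
      by (intro integral_mono abs_inner_le e integrable_abs integrable_square_int_inner)
        (simp_all add: square_int_def)
    also have "\<dots> = (L2_norm (\<lambda>x. f x - g x))\<^sup>2 / e + e * M"
      using sfg psi by (simp add: square_int_def L2_norm_power2 M_def)
    also have "\<dots> \<le> e\<^sup>2 / e + e * M"
      using power_mono[OF less_imp_le[OF ge] L2_norm_nonneg, of 2] e by (simp add: divide_right_mono)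
    also have "\<dots> = e * (1 + M)" using e by (simp add: power2_eq_square algebra_simps)
    finally show ?thesis .
  qed
  show ?thesis
  proof (rule ccontr)
    assume "(LINT x|torus. f x \<bullet> \<psi> x) \<noteq> 0"
    then have pos: "\<bar>LINT x|torus. f x \<bullet> \<psi> x\<bar> > 0" by simp
    have "\<bar>LINT x|torus. f x \<bullet> \<psi> x\<bar> \<le> \<bar>LINT x|torus. f x \<bullet> \<psi> x\<bar> / (2 * (1 + M)) * (1 + M)"
      using pos M by (intro small) auto
    also have "\<dots> = \<bar>LINT x|torus. f x \<bullet> \<psi> x\<bar> / 2"
    proof -
      have "z / (2 * K) * K = z / 2" if "K \<noteq> 0" for z K :: real using that by simp
      then show ?thesis using M by (smt (verit))
    qed
    finally show False using pos by linarith
  qed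
qed

lemma H_space_square_int: "f \<in> H_space \<Longrightarrow> square_int f"
  using L2_imp_square_int by (auto simp: H_space_def)

lemma H_space_coef_0:
  assumes "f \<in> H_space" shows "coef f 0 a = 0"
proof -
  have "coef f 0 a \<bullet> e = 0" for e
    unfolding coef_inner[OF H_space_square_int[OF assms]]
  proof (rule H_space_orthogonal[OF assms])
    show "square_int (\<lambda>x. wave 0 a x *\<^sub>R e)"
      by (intro square_int_continuous continuous_intros)
    fix g :: "real ^ 3 \<Rightarrow> real ^ 3" assume g: "g \<in> smooth_torus" "(LINT x|torus. g x) = 0"
    have "(LINT x|torus. g x \<bullet> (cos a *\<^sub>R e)) = (LINT x|torus. g x) \<bullet> (cos a *\<^sub>R e)"
      by (intro integral_inner_left integrable_torus_continuous smooth_torus_continuous g)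
    then show "(LINT x|torus. g x \<bullet> (wave 0 a x *\<^sub>R e)) = 0"
      by (simp add: wave_def g(2))
  qed
  then show ?thesis by (metis inner_eq_zero_iff)
qed

text \<open>
  The Fourier side of $\nabla\cdot f = 0$. For smooth fields it is the divergence theorem for the
  product of the field with a wave.
\<close>

lemma H_space_coef_div:
  assumes f: "f \<in> H_space" and k: "k \<in> freq" shows "coef f k a \<bullet> k = 0"
  unfolding coef_inner[OF H_space_square_int[OF f]]
proof (rule H_space_orthogonal[OF f])
  show "square_int (\<lambda>x. wave k a x *\<^sub>R k)"
    by (intro square_int_continuous continuous_intros)
  fix g :: "real ^ 3 \<Rightarrow> real ^ 3" assume g: "g \<in> smooth_torus" and div0: "\<And>x. div_field g x = 0"
  let ?D = "\<lambda>x. frechet_derivative g (at x)"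
  let ?G = "\<lambda>x v. wave k (a - pi/2) x *\<^sub>R ?D x v + (2 * pi * (k \<bullet> v) * wave k (a - pi/2 + pi/2) x) *\<^sub>R g x"
  have "integral (cbox 0 One) (\<lambda>x. \<Sum>i\<in>UNIV. ?G x (axis i 1) $ i) = 0"
  proof (rule integral_torus_divergence_eq_0)
    show "periodic (\<lambda>x. wave k (a - pi/2) x *\<^sub>R g x)"
      using periodic_wave[OF k] g by (simp add: periodic_def smooth_torus_def)
    show "((\<lambda>x. wave k (a - pi/2) x *\<^sub>R g x) has_derivative ?G x) (at x)" for x
      by (rule has_derivative_scaleR[OF wave_has_derivative smooth_torus_has_derivative[OF g]])
    show "continuous_on UNIV (\<lambda>x. ?G x v)" for v
      by (intro continuous_intros smooth_torus_continuous_derivative smooth_torus_continuous g)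
  qed
  moreover have "(\<Sum>i\<in>UNIV. ?G x (axis i 1) $ i) = 2 * pi * (g x \<bullet> (wave k a x *\<^sub>R k))" for x
  proof -
    have "(\<Sum>i\<in>UNIV. ?G x (axis i 1) $ i) = wave k (a - pi/2) x * (\<Sum>i\<in>UNIV. ?D x (axis i 1) $ i)
       + 2 * pi * wave k a x * (\<Sum>i\<in>UNIV. g x $ i * k $ i)"
      by (simp add: sum.distrib sum_distrib_left inner_axis algebra_simps)
    also have "(\<Sum>i\<in>UNIV. ?D x (axis i 1) $ i) = 0"
      using div0[of x] div_field_eq[OF smooth_torus_has_derivative[OF g, of x]] by simp
    finally have "(\<Sum>i\<in>UNIV. ?G x (axis i 1) $ i) = 2 * pi * wave k a x * (\<Sum>i\<in>UNIV. g x $ i * k $ i)"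
      by (simp only: mult_zero_right add_0_left)
    moreover have "g x \<bullet> (wave k a x *\<^sub>R k) = wave k a x * (\<Sum>i\<in>UNIV. g x $ i * k $ i)"
      by (simp only: inner_scaleR_right) (simp only: inner_vec_def inner_real_def)
    ultimately show ?thesis
      by (simp only: mult.assoc)
  qed
  ultimately have "integral (cbox 0 One) (\<lambda>x. 2 * pi * (g x \<bullet> (wave k a x *\<^sub>R k))) = 0" by simp
  then have "integral (cbox 0 One) (\<lambda>x. g x \<bullet> (wave k a x *\<^sub>R k)) = 0"
    by (simp del: inner_scaleR_right)
  moreover have "continuous_on UNIV (\<lambda>x. g x \<bullet> (wave k a x *\<^sub>R k))"
    by (intro continuous_intros smooth_torus_continuous g)
  ultimately show "(LINT x|torus. g x \<bullet> (wave k a x *\<^sub>R k)) = 0"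
    by (simp only: integral_torus_continuous)
qed

lemma H_space_continuous_approx:
  assumes f: "f \<in> H_space" and v: "v \<in> smooth_torus"
  shows "continuous_approx (\<lambda>x. f x - v x)"
  unfolding continuous_approx_def
proof (intro allI impI)
  fix e :: real assume "e > 0"
  then obtain g where g: "g \<in> smooth_torus" "L2_norm (\<lambda>x. f x - g x) < e"
    using f unfolding H_space_def by blast
  have "periodic (\<lambda>x. g x - v x)" using g(1) v by (simp add: periodic_def smooth_torus_def)
  then show "\<exists>g. continuous_on UNIV g \<and> periodic g \<and> L2_norm (\<lambda>x. f x - v x - g x) < e"
    using g by (intro exI[of _ "\<lambda>x. g x - v x"])
      (auto intro!: continuous_on_diff smooth_torus_continuous[OF g(1)] smooth_torus_continuous[OF v])
qed

lemma AE_eq_if_coef_eq: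
  assumes f: "f \<in> H_space" and v: "v \<in> smooth_torus"
    and eq: "\<And>k a. k \<in> freq \<Longrightarrow> coef f k a = coef v k a"
  shows "AE x in torus. f x = v x"
proof -
  have sv: "square_int v" using smooth_torus_continuous[OF v] by (rule square_int_continuous)
  have sfv: "square_int (\<lambda>x. f x - v x)"
    by (rule square_int_diff[OF H_space_square_int[OF f] sv])
  have "AE x in torus. f x - v x = 0"
  proof (rule AE_eq_0_if_orthogonal_to_waves[OF sfv H_space_continuous_approx[OF f v]])
    fix k a i assume "k \<in> freq"
    then show "(LINT x|torus. (f x - v x) \<bullet> (wave k a x *\<^sub>R axis i 1)) = 0"
      using coef_inner[OF sfv, of k a "axis i 1"] eq[of k a]
      by (simp only: coef_diff[OF H_space_square_int[OF f] sv]) simp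
  qed
  then show ?thesis by simp
qed

text \<open>
  The Fourier side of $\nabla\times u = l u$, from testing with a single wave.
\<close>

lemma coef_Beltrami:
  assumes u: "square_int u" and B: "has_distr_curl u (\<lambda>x. l *\<^sub>R u x)" and k: "k \<in> freq"
  shows "l *\<^sub>R coef u k a = (2 * pi) *\<^sub>R cross3 (coef u k (a + pi/2)) k"
proof -
  have "(l *\<^sub>R coef u k a) \<bullet> e = ((2 * pi) *\<^sub>R cross3 (coef u k (a + pi/2)) k) \<bullet> e" for e
  proof -
    let ?\<psi> = "\<lambda>x. wave k a x *\<^sub>R e"
    have "(?\<psi> has_derivative (\<lambda>v. (2 * pi * wave k (a + pi/2) x * (k \<bullet> v)) *\<^sub>R e)) (at x)" for x
      by (rule has_derivative_eq_rhs[OF has_derivative_scaleR_left[OF wave_has_derivative]]) (simp add: ac_simps)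
    from curl_eq[OF this]
    have curl: "curl ?\<psi> x = (2 * pi * wave k (a + pi/2) x) *\<^sub>R cross3 k e" for x
      by (simp only: curl_of_plane)
    have "(l *\<^sub>R coef u k a) \<bullet> e = L2_inner (\<lambda>x. l *\<^sub>R u x) ?\<psi>"
      by (simp only: coef_inner[OF u] L2_inner_def inner_scaleR_left integral_mult_right_zero)
    also have "\<dots> = L2_inner u (curl ?\<psi>)"
      using B wave_smooth_torus[OF k] unfolding has_distr_curl_def by blast
    also have "\<dots> = (LINT x|torus. (2 * pi) * (u x \<bullet> (wave k (a + pi/2) x *\<^sub>R cross3 k e)))"
      unfolding L2_inner_def curl by (simp add: ac_simps)
    also have "\<dots> = 2 * pi * (coef u k (a + pi/2) \<bullet> cross3 k e)"
      by (simp add: coef_inner[OF u] del: inner_scaleR_right)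
    also have "\<dots> = ((2 * pi) *\<^sub>R cross3 (coef u k (a + pi/2)) k) \<bullet> e"
      by (simp add: cross3_simps)
    finally show ?thesis .
  qed
  then show ?thesis by (metis vector_eq_rdot)
qed

lemma coef_add_pi: "coef u k (a + pi) = - coef u k a"
  by (simp add: coef_def wave_add_pi)

text \<open>
  Using the previous relation twice gives $l^2 c = 4\pi^2 |k|^2 c$ for each coefficient $c \perp k$:
  a Beltrami field has only frequencies on one sphere. The zero frequency is excluded by the zero
  mean.
\<close>

lemma coef_resonance:
  assumes u: "u \<in> H_space" and B: "has_distr_curl u (\<lambda>x. l *\<^sub>R u x)" and k: "k \<in> freq"
    and nz: "coef u k a \<noteq> 0"
  shows "k \<noteq> 0 \<and> l\<^sup>2 = 4 * pi\<^sup>2 * (k \<bullet> k)"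
proof -
  note Bel = coef_Beltrami[OF H_space_square_int[OF u] B k]
  have "l\<^sup>2 *\<^sub>R coef u k a = l *\<^sub>R ((2 * pi) *\<^sub>R cross3 (coef u k (a + pi/2)) k)"
    by (simp add: power2_eq_square flip: Bel)
  also have "\<dots> = (2 * pi) *\<^sub>R cross3 (l *\<^sub>R coef u k (a + pi/2)) k"
    by (simp add: cross3_simps)
  also have "l *\<^sub>R coef u k (a + pi/2) = (2 * pi) *\<^sub>R cross3 (- coef u k a) k"
    using Bel[of "a + pi/2"] coef_add_pi[of u k a] by (simp add: add.assoc)
  also have "(2 * pi) *\<^sub>R cross3 ((2 * pi) *\<^sub>R cross3 (- coef u k a) k) k
      = (4 * pi\<^sup>2) *\<^sub>R ((k \<bullet> k) *\<^sub>R coef u k a - (coef u k a \<bullet> k) *\<^sub>R k)"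
    by (simp add: vec_eq_iff forall_3 cross3_def inner_vec_def sum_3 power2_eq_square algebra_simps)
  also have "\<dots> = (4 * pi\<^sup>2 * (k \<bullet> k)) *\<^sub>R coef u k a"
    by (simp add: H_space_coef_div[OF u k])
  finally have "l\<^sup>2 = 4 * pi\<^sup>2 * (k \<bullet> k)" using nz by simp
  moreover have "k \<noteq> 0" using nz H_space_coef_0[OF u] by auto
  ultimately show ?thesis by simp
qed

text \<open>
  The nonzero frequencies on the sphere that the factor \<open>l\<close> selects.
\<close>

definition resonant :: "real \<Rightarrow> (real ^ 3) set" where
  "resonant l = {k\<in>freq. k \<noteq> 0 \<and> l\<^sup>2 = 4 * pi\<^sup>2 * (k \<bullet> k)}"

lemma finite_resonant: "finite (resonant l)"
proof -
  \<comment> \<open>From $|k| \le |k|^2 + 1$ and $|k|^2 = l^2/(4\pi^2)$.\<close>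
  define N where "N = l\<^sup>2 / (4 * pi\<^sup>2) + 1"
  have bd: "\<bar>k $ i\<bar> \<le> N" if "k \<in> resonant l" for k i
  proof -
    have "\<bar>k $ i\<bar> \<le> norm k" by (rule component_le_norm_cart)
    also have "\<dots> \<le> (norm k)\<^sup>2 + 1"
      using zero_le_power2[of "norm k - 1/2"] unfolding power2_diff by (simp add: power_divide)
    also have "(norm k)\<^sup>2 = l\<^sup>2 / (4 * pi\<^sup>2)"
      using that by (simp add: resonant_def power2_norm_eq_inner)
    finally show ?thesis by (simp add: N_def)
  qed
  let ?I = "{n \<in> \<int>. \<bar>n\<bar> \<le> N}"
  have fin: "finite ?I" using finite_abs_int_segment[of N] by simp
  have "resonant l \<subseteq> (\<lambda>(a, b, c). vector [a, b, c]) ` (?I \<times> ?I \<times> ?I)"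
  proof
    fix k assume k: "k \<in> resonant l"
    have "k = vector [k $ 1, k $ 2, k $ 3]" by (simp add: vec_eq_iff forall_3)
    moreover have "(k $ 1, k $ 2, k $ 3) \<in> ?I \<times> ?I \<times> ?I"
      using k bd[OF k] by (auto simp: resonant_def freq_def)
    ultimately show "k \<in> (\<lambda>(a, b, c). vector [a, b, c]) ` (?I \<times> ?I \<times> ?I)"
      by (metis (no_types, lifting) case_prod_conv image_eqI)
  qed
  then show ?thesis by (rule finite_subset) (intro finite_imageI finite_cartesian_product fin)
qed

text \<open>
  The contribution of one frequency to \<open>u\<close>. Summation runs over \<open>k\<close> and \<open>- k\<close> separately, hence
  there is no factor 2.
\<close>

definition mode :: "(real ^ 3 \<Rightarrow> real ^ 3) \<Rightarrow> real ^ 3 \<Rightarrow> real ^ 3 \<Rightarrow> real ^ 3" where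
  "mode u k x = wave k 0 x *\<^sub>R coef u k 0 + wave k (pi/2) x *\<^sub>R coef u k (pi/2)"

lemma mode_smooth_torus: "k \<in> freq \<Longrightarrow> mode u k \<in> smooth_torus"
  using add_smooth_torus[OF wave_smooth_torus wave_smooth_torus] unfolding mode_def[abs_def] by blast

lemma coef_mode:
  assumes u: "square_int u" and k: "k \<in> freq" "k \<noteq> 0" and m: "m \<in> freq"
  shows "coef (mode u k) m b
    = ((if k = m then coef u m b else 0) + (if k = - m then coef u m b else 0)) /\<^sub>R 2"
proof -
  have "coef (mode u k) m b = (LINT x|torus. (wave m b x * wave k 0 x) *\<^sub>R coef u k 0
      + (wave m b x * wave k (pi/2) x) *\<^sub>R coef u k (pi/2))"
    by (simp add: coef_def mode_def scaleR_add_right)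
  also have "\<dots> = (LINT x|torus. wave m b x * wave k 0 x) *\<^sub>R coef u k 0
      + (LINT x|torus. wave m b x * wave k (pi/2) x) *\<^sub>R coef u k (pi/2)"
  proof -
    have "integrable torus (\<lambda>x. wave m b x * wave k c x)" for c
      by (intro integrable_torus_continuous continuous_intros)
    then show ?thesis by simp
  qed
  also have "\<dots> = (((if k = m then cos b else 0) + (if k = - m then cos b else 0)) / 2) *\<^sub>R coef u k 0
      + (((if k = m then sin b else 0) + (if k = - m then - sin b else 0)) / 2) *\<^sub>R coef u k (pi/2)"
    unfolding LINT_wave_mult[OF m k(1)] using equation_minus_iff[of m k]
    by (auto simp: cos_add cos_diff eq_commute[of m k])
  also have "\<dots> = ((if k = m then cos b *\<^sub>R coef u m 0 + sin b *\<^sub>R coef u m (pi/2) else 0)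
     + (if k = - m then cos b *\<^sub>R coef u m 0 + sin b *\<^sub>R coef u m (pi/2) else 0)) /\<^sub>R 2"
  proof -
    have "coef u (- m) 0 = coef u m 0" "coef u (- m) (pi/2) = - coef u m (pi/2)"
      using coef_uminus[of u m] coef_add_pi[of u m "- pi/2"] by simp_all
    \<comment> \<open>The two cases below exclude each other because \<open>k\<close> is not zero.\<close>
    moreover have "m \<noteq> - m" if "k = m"
      using k(2) that by (simp add: eq_neg_iff_add_eq_0 flip: scaleR_2)
    ultimately show ?thesis by (auto simp: scaleR_add_right)
  qed
  finally show ?thesis by (simp flip: coef_phase[OF u])
qed

lemma mode_derivative:
  "(mode u k has_derivative
     (\<lambda>v. (2 * pi * (k \<bullet> v)) *\<^sub>R (wave k (pi/2) x *\<^sub>R coef u k 0 - wave k 0 x *\<^sub>R coef u k (pi/2)))) (at x)"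
proof -
  have "wave k (pi/2 + pi/2) x = - wave k 0 x" using wave_add_pi[of k 0 x] by simp
  then show ?thesis
    unfolding mode_def
    by (intro has_derivative_eq_rhs[OF has_derivative_add[OF
        has_derivative_scaleR_left[OF wave_has_derivative]
        has_derivative_scaleR_left[OF wave_has_derivative]]])
      (auto simp: fun_eq_iff algebra_simps)
qed

text \<open>
  A Beltrami field in the sense of distributions is a trigonometric polynomial: the sum of its
  finitely many resonant modes has the same Fourier coefficients. Each mode is by itself
  solenoidal and an eigenfield of the curl.
\<close>

proposition Beltrami_field_smooth:
  assumes u: "u \<in> H_space" and B: "has_distr_curl u (\<lambda>x. l *\<^sub>R u x)"
  obtains v where "v \<in> smooth_torus" "\<And>x. div_field v x = 0" "\<And>x. curl v x = l *\<^sub>R v x"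
    "AE x in torus. u x = v x"
proof
  note su = H_space_square_int[OF u]
  define v where "v = (\<lambda>x. \<Sum>k\<in>resonant l. mode u k x)"
  have R: "k \<in> freq" if "k \<in> resonant l" for k using that by (simp add: resonant_def)
  have R0: "k \<noteq> 0" if "k \<in> resonant l" for k using that by (simp add: resonant_def)
  show v: "v \<in> smooth_torus"
    unfolding v_def by (intro sum_smooth_torus mode_smooth_torus R)
  let ?w = "\<lambda>k x. wave k (pi/2) x *\<^sub>R coef u k 0 - wave k 0 x *\<^sub>R coef u k (pi/2)"
  have der: "(v has_derivative (\<lambda>h. \<Sum>k\<in>resonant l. (2 * pi * (k \<bullet> h)) *\<^sub>R ?w k x)) (at x)" for x
    unfolding v_def by (intro has_derivative_sum mode_derivative)
  show "div_field v x = 0" for x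
  proof -
    have "div_field v x = (\<Sum>k\<in>resonant l. \<Sum>i\<in>UNIV. ((2 * pi * (k \<bullet> axis i 1)) *\<^sub>R ?w k x) $ i)"
      unfolding div_field_eq[OF der] sum_component by (rule sum.swap)
    also have "\<dots> = (\<Sum>k\<in>resonant l. 2 * pi * (?w k x \<bullet> k))"
    proof (intro sum.cong refl)
      fix k
      show "(\<Sum>i\<in>UNIV. ((2 * pi * (k \<bullet> axis i 1)) *\<^sub>R ?w k x) $ i) = 2 * pi * (?w k x \<bullet> k)"
        unfolding inner_vec_def[of "?w k x" k] sum_distrib_left by (simp add: inner_axis algebra_simps)
    qed
    also have "\<dots> = 0"
      by (intro sum.neutral ballI) (simp add: inner_diff_left H_space_coef_div[OF u R])
    finally show ?thesis .
  qed
  show "curl v x = l *\<^sub>R v x" for x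
  proof -
    have "curl v x = (\<Sum>k\<in>resonant l. (2 * pi) *\<^sub>R cross3 k (?w k x))"
      unfolding curl_eq[OF der] curl_of_sum curl_of_plane ..
    also have "\<dots> = (\<Sum>k\<in>resonant l. l *\<^sub>R mode u k x)"
    proof (intro sum.cong refl)
      fix k assume k: "k \<in> resonant l"
      have 1: "l *\<^sub>R coef u k 0 = (2 * pi) *\<^sub>R cross3 (coef u k (pi/2)) k"
        and 2: "l *\<^sub>R coef u k (pi/2) = - ((2 * pi) *\<^sub>R cross3 (coef u k 0) k)"
        using coef_Beltrami[OF su B R[OF k], of 0] coef_Beltrami[OF su B R[OF k], of "pi/2"]
          coef_add_pi[of u k 0] by simp_all
      have "l *\<^sub>R mode u k x = wave k 0 x *\<^sub>R (l *\<^sub>R coef u k 0) + wave k (pi/2) x *\<^sub>R (l *\<^sub>R coef u k (pi/2))"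
        by (simp add: mode_def algebra_simps)
      also have "\<dots> = (2 * pi) *\<^sub>R cross3 k (?w k x)"
        unfolding 1 2 by (simp add: cross3_simps)
      finally show "(2 * pi) *\<^sub>R cross3 k (?w k x) = l *\<^sub>R mode u k x" ..
    qed
    also have "\<dots> = l *\<^sub>R v x" by (simp add: v_def scaleR_sum_right)
    finally show ?thesis .
  qed
  show "AE x in torus. u x = v x"
  proof (rule AE_eq_if_coef_eq[OF u v])
    fix m b assume m: "m \<in> freq"
    have smode: "square_int (mode u k)" if "k \<in> freq" for k
      by (rule square_int_continuous[OF smooth_torus_continuous[OF mode_smooth_torus[OF that]]])
    have "coef v m b = (\<Sum>k\<in>resonant l. coef (mode u k) m b)"
      unfolding coef_def v_def scaleR_sum_right
      by (intro Bochner_Integration.integral_sum integrable_wave_scaleR smode R)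
    also have "\<dots> = (\<Sum>k\<in>resonant l. (if k = m then coef u m b else 0) /\<^sub>R 2)
        + (\<Sum>k\<in>resonant l. (if k = - m then coef u m b else 0) /\<^sub>R 2)"
      by (simp add: coef_mode[OF su R R0 m] scaleR_add_right sum.distrib cong: sum.cong)
    also have "\<dots> = (if m \<in> resonant l then coef u m b else 0) /\<^sub>R 2
        + (if - m \<in> resonant l then coef u m b else 0) /\<^sub>R 2"
      by (simp add: finite_resonant flip: scaleR_sum_right)
    also have "- m \<in> resonant l \<longleftrightarrow> m \<in> resonant l"
      using m freq_uminus[OF m] by (auto simp: resonant_def)
    also have "(if m \<in> resonant l then coef u m b else 0) /\<^sub>R 2 + (if m \<in> resonant l then coef u m b else 0) /\<^sub>R 2
        = coef u m b"
      using coef_resonance[OF u B m, of b] m by (auto simp: resonant_def simp flip: scaleR_add_left)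
    finally show "coef u m b = coef v m b" ..
  qed
qed

section \<open>Smooth Beltrami fields as stationary solutions\<close>

text \<open>
  With \<open>L\<close> the derivative of a field at a point and \<open>w\<close> its value, this is
  $(w\cdot\nabla)w = \nabla |w|^2/2$: the remaining term $(\nabla\times w)\times w$ of the vector
  identity vanishes because the curl is parallel to \<open>w\<close>.
\<close>

lemma Beltrami_advection:
  assumes "curl_of L = l *\<^sub>R w"
  shows "(\<Sum>j\<in>UNIV. w $ j * L (axis j 1) $ i) = w \<bullet> L (axis i 1)"
proof -
  have 1: "L (axis 2 1) $ 3 = L (axis 3 1) $ 2 + l * w $ 1"
    and 2: "L (axis 3 1) $ 1 = L (axis 1 1) $ 3 + l * w $ 2"
    and 3: "L (axis 1 1) $ 2 = L (axis 2 1) $ 1 + l * w $ 3"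
    using assms by (simp_all add: curl_of_def vec_eq_iff forall_3 algebra_simps)
  show ?thesis
    using exhaust_3[of i] by (auto simp: inner_vec_def sum_3 1 2 3 algebra_simps)
qed

text \<open>
  The nonlinear term of a smooth Beltrami field is a gradient, hence invisible to solenoidal test
  fields. The integrand is the divergence of $(v\cdot\phi)v - \frac12|v|^2\phi$.
\<close>

lemma Beltrami_stress_orthogonal:
  assumes v: "v \<in> smooth_torus" and dv: "\<And>x. div_field v x = 0"
    and cv: "\<And>x. curl v x = l *\<^sub>R v x"
    and per: "periodic \<phi>" and der: "\<And>x. (\<phi> has_derivative \<phi>' x) (at x)"
    and cont: "\<And>h. continuous_on UNIV (\<lambda>x. \<phi>' x h)"
    and dphi: "\<And>x. div_field \<phi> x = 0"
  shows "L2_inner (\<lambda>x. outer (v x) (v x)) (Jac \<phi>) = 0"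
proof -
  let ?D = "\<lambda>x. frechet_derivative v (at x)"
  note vder = smooth_torus_has_derivative[OF v]
  have cphi: "continuous_on UNIV \<phi>"
    using der by (meson continuous_at_imp_continuous_on has_derivative_continuous)
  have cvv: "continuous_on UNIV v" by (rule smooth_torus_continuous[OF v])
  let ?G' = "\<lambda>x h. (v x \<bullet> \<phi> x) *\<^sub>R ?D x h + (v x \<bullet> \<phi>' x h + ?D x h \<bullet> \<phi> x) *\<^sub>R v x
      - ((1/2 * (v x \<bullet> v x)) *\<^sub>R \<phi>' x h + (1/2 * (v x \<bullet> ?D x h + ?D x h \<bullet> v x)) *\<^sub>R \<phi> x)"
  have "integral (cbox 0 One) (\<lambda>x. \<Sum>i\<in>UNIV. ?G' x (axis i 1) $ i) = 0"
  proof (rule integral_torus_divergence_eq_0)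
    show "periodic (\<lambda>x. (v x \<bullet> \<phi> x) *\<^sub>R v x - (1/2 * (v x \<bullet> v x)) *\<^sub>R \<phi> x)"
      using per v by (simp add: periodic_def smooth_torus_def)
    show "((\<lambda>x. (v x \<bullet> \<phi> x) *\<^sub>R v x - (1/2 * (v x \<bullet> v x)) *\<^sub>R \<phi> x) has_derivative ?G' x) (at x)" for x
      by (intro has_derivative_diff has_derivative_scaleR has_derivative_inner
          has_derivative_mult_right vder der)
    show "continuous_on UNIV (\<lambda>x. ?G' x h)" for h
      by (intro continuous_intros cont cphi cvv smooth_torus_continuous_derivative[OF v])
  qed
  moreover have "(\<Sum>i\<in>UNIV. ?G' x (axis i 1) $ i) = outer (v x) (v x) \<bullet> Jac \<phi> x" for x
  proof -
    have adv: "(\<Sum>j\<in>UNIV. v x $ j * ?D x (axis j 1) $ i) = v x \<bullet> ?D x (axis i 1)" for i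
      using curl_eq[OF vder[of x]] cv by (intro Beltrami_advection[where l = l]) simp
    have "(\<Sum>i\<in>UNIV. ?G' x (axis i 1) $ i)
      = (v x \<bullet> \<phi> x) * (\<Sum>i\<in>UNIV. ?D x (axis i 1) $ i)
        - 1/2 * (v x \<bullet> v x) * (\<Sum>i\<in>UNIV. \<phi>' x (axis i 1) $ i)
        + (\<Sum>i\<in>UNIV. (v x \<bullet> \<phi>' x (axis i 1)) * v x $ i)
        + ((\<Sum>i\<in>UNIV. (?D x (axis i 1) \<bullet> \<phi> x) * v x $ i)
        - (\<Sum>i\<in>UNIV. (v x \<bullet> ?D x (axis i 1)) * \<phi> x $ i))"
      by (simp add: sum.distrib sum_subtractf sum_distrib_left algebra_simps inner_commute[of "?D x _" "v x"])
    also have "(\<Sum>i\<in>UNIV. ?D x (axis i 1) $ i) = 0"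
      using dv[of x] div_field_eq[OF vder] by simp
    also have "(\<Sum>i\<in>UNIV. \<phi>' x (axis i 1) $ i) = 0"
      using dphi[of x] div_field_eq[OF der] by simp
    also have "(\<Sum>i\<in>UNIV. (v x \<bullet> ?D x (axis i 1)) * \<phi> x $ i)
        = (\<Sum>i\<in>UNIV. (\<Sum>j\<in>UNIV. v x $ j * ?D x (axis j 1) $ i) * \<phi> x $ i)"
      by (simp only: adv)
    also have "\<dots> = (\<Sum>i\<in>UNIV. (?D x (axis i 1) \<bullet> \<phi> x) * v x $ i)"
      by (simp add: inner_vec_def sum_distrib_left sum_distrib_right ac_simps) (rule sum.swap)
    also have "(\<Sum>i\<in>UNIV. (v x \<bullet> \<phi>' x (axis i 1)) * v x $ i) = outer (v x) (v x) \<bullet> Jac \<phi> x"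
      unfolding inner_vec_def sum_distrib_left sum_distrib_right outer_def
      by (subst sum.swap) (simp add: Jac_eq[OF der] ac_simps)
    finally show ?thesis by simp
  qed
  moreover have "continuous_on UNIV (\<lambda>x. outer (v x) (v x) \<bullet> Jac \<phi> x)"
    unfolding outer_def inner_vec_def by (simp add: Jac_eq[OF der]) (intro continuous_intros cvv cont)
  ultimately show ?thesis
    unfolding L2_inner_def by (simp add: integral_torus_continuous)
qed

lemma Beltrami_stationary_classical:
  assumes T: "T > 0" and v: "v \<in> smooth_torus" and dv: "\<And>x. div_field v x = 0"
    and cv: "\<And>x. curl v x = l *\<^sub>R v x" and u0: "AE x in torus. v x = u0 x"
  shows "classical_Euler T u0 (\<lambda>t. v)"
proof -
  let ?D = "\<lambda>x. frechet_derivative v (at x)"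
  let ?S = "{0..T} \<times> (UNIV :: (real ^ 3) set)"
  note vder = smooth_torus_has_derivative[OF v]
  have cvv: "continuous_on UNIV v" by (rule smooth_torus_continuous[OF v])
  have per: "periodic v" using v by (simp add: smooth_torus_def)
  have C1: "C_on 1 ?S (\<lambda>(t, x). v x)"
    unfolding One_nat_def
  proof (rule C_on_SucI[OF approachable_slabs(2)[OF T]])
    show "((\<lambda>(t, x). v x) has_derivative (\<lambda>h. ?D (snd p) (snd h))) (at p within ?S)" for p
      unfolding case_prod_beta
      by (rule has_derivative_compose[of snd, OF _ vder]) (auto intro!: derivative_eq_intros)
    show "C_on 0 ?S (\<lambda>p. ?D (snd p) (snd h))" for h :: "real \<times> (real ^ 3)"
      by (auto intro!: continuous_on_compose2[OF smooth_torus_continuous_derivative[OF v]] continuous_intros)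
  qed
  \<comment> \<open>The Bernoulli pressure balances the advection term.\<close>
  let ?p = "\<lambda>x. - 1/2 * (v x \<bullet> v x)"
  have pder: "(?p has_derivative (\<lambda>h. - (v x \<bullet> ?D x h))) (at x)" for x
    by (rule has_derivative_eq_rhs[OF has_derivative_mult_right[OF has_derivative_inner[OF vder vder]]])
      (simp add: inner_commute)
  have Cp: "C_on 1 UNIV ?p"
    unfolding One_nat_def
    by (rule C_on_SucI[OF approachable_UNIV pder])
      (auto intro!: continuous_intros cvv smooth_torus_continuous_derivative[OF v])
  have eq: "Jac v x *v v x + grad ?p x = 0" for x
  proof -
    have "(\<Sum>j\<in>UNIV. v x $ j * ?D x (axis j 1) $ i) = v x \<bullet> ?D x (axis i 1)" for i
      using curl_eq[OF vder[of x]] cv by (intro Beltrami_advection[where l = l]) simp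
    moreover have "grad ?p x = (\<chi> i. - (v x \<bullet> ?D x (axis i 1)))"
      unfolding grad_def partial_eq[OF pder] ..
    ultimately show ?thesis
      by (simp add: vec_eq_iff matrix_vector_mult_def Jac_eq[OF vder] mult.commute)
  qed
  have vd: "vector_derivative (\<lambda>s. v x) (at t within {0..T}) = 0" if "t \<in> {0..T}" for t x
    using T that vector_derivative_within_cbox[of 0 T t "\<lambda>s. v x" 0] by simp
  show ?thesis
    unfolding classical_Euler_def
    using C1 per dv Cp u0 eq vd
    by (auto intro!: exI[of _ "\<lambda>t. ?p"] continuous_on_compose2[OF cvv] continuous_intros
        simp: case_prod_beta periodic_def)
qed

lemma outer_inner: "outer a b \<bullet> J = (\<Sum>i\<in>UNIV. \<Sum>j\<in>UNIV. (a $ i * b $ j) * J $ i $ j)"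
  by (simp add: outer_def inner_vec_def)

lemma Beltrami_stress_orthogonal_weak:
  assumes u: "u \<in> H_space" and B: "has_distr_curl u (\<lambda>x. l *\<^sub>R u x)"
    and phi: "\<phi> \<in> smooth_torus" and dphi: "\<And>x. div_field \<phi> x = 0"
  shows "L2_inner (\<lambda>x. outer (u x) (u x)) (Jac \<phi>) = 0"
proof -
  obtain v where v: "v \<in> smooth_torus" "\<And>x. div_field v x = 0" "\<And>x. curl v x = l *\<^sub>R v x"
    "AE x in torus. u x = v x"
    using Beltrami_field_smooth[OF u B] by blast
  note der = smooth_torus_has_derivative[OF phi] and cder = smooth_torus_continuous_derivative[OF phi]
  have m: "(\<lambda>x. outer (f x) (f x) \<bullet> Jac \<phi> x) \<in> borel_measurable torus"
    if f: "f \<in> borel_measurable torus" for f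
  proof -
    have "(\<lambda>x. f x $ i) \<in> borel_measurable torus" for i
      using borel_measurable_inner[OF f borel_measurable_const[of "axis i 1"]] by (simp add: inner_axis)
    moreover have "(\<lambda>x. Jac \<phi> x $ i $ j) \<in> borel_measurable torus" for i j
      unfolding Jac_eq[OF der]
      by (intro borel_measurable_integrable integrable_torus_continuous continuous_intros cder)
    ultimately show ?thesis unfolding outer_inner by (intro borel_measurable_sum borel_measurable_times)
  qed
  have "L2_inner (\<lambda>x. outer (u x) (u x)) (Jac \<phi>) = L2_inner (\<lambda>x. outer (v x) (v x)) (Jac \<phi>)"
    unfolding L2_inner_def
  proof (rule integral_cong_AE)
    show "(\<lambda>x. outer (u x) (u x) \<bullet> Jac \<phi> x) \<in> borel_measurable torus"
      using H_space_square_int[OF u] by (intro m) (simp add: square_int_def)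
    show "(\<lambda>x. outer (v x) (v x) \<bullet> Jac \<phi> x) \<in> borel_measurable torus"
      by (intro m borel_measurable_integrable integrable_torus_continuous smooth_torus_continuous v)
    show "AE x in torus. outer (u x) (u x) \<bullet> Jac \<phi> x = outer (v x) (v x) \<bullet> Jac \<phi> x"
      using v(4) by eventually_elim simp
  qed
  also have "\<dots> = 0"
    by (rule Beltrami_stress_orthogonal[OF v(1-3) _ der cder dphi]) (use phi in \<open>simp add: smooth_torus_def\<close>)
  finally show ?thesis .
qed

section \<open>Uniqueness of classical solutions\<close>

text \<open>
  The derivatives in time and space of a velocity field and a pressure on the closed slab, with the
  Euler equations written in terms of them.
\<close>

definition Euler_derivatives ::
  "real \<Rightarrow> (real \<Rightarrow> real ^ 3 \<Rightarrow> real ^ 3) \<Rightarrow> (real \<Rightarrow> real ^ 3 \<Rightarrow> real ^ 3)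
    \<Rightarrow> (real \<Rightarrow> real ^ 3 \<Rightarrow> real ^ 3 \<Rightarrow> real ^ 3) \<Rightarrow> (real \<Rightarrow> real ^ 3 \<Rightarrow> real)
    \<Rightarrow> (real \<Rightarrow> real ^ 3 \<Rightarrow> real ^ 3 \<Rightarrow> real) \<Rightarrow> bool" where
  "Euler_derivatives T v Vt Vx q Q \<longleftrightarrow>
     continuous_on ({0..T} \<times> UNIV) (\<lambda>(t, x). v t x)
     \<and> continuous_on ({0..T} \<times> UNIV) (\<lambda>(t, x). Vt t x)
     \<and> (\<forall>h. continuous_on ({0..T} \<times> UNIV) (\<lambda>(t, x). Vx t x h))
     \<and> (\<forall>t\<in>{0..T}. \<forall>x. ((\<lambda>s. v s x) has_vector_derivative Vt t x) (at t within {0..T}))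
     \<and> (\<forall>t\<in>{0..T}. \<forall>x. (v t has_derivative Vx t x) (at x))
     \<and> (\<forall>t\<in>{0..T}. periodic (v t) \<and> periodic (q t))
     \<and> (\<forall>t\<in>{0..T}. \<forall>x. (\<Sum>i\<in>UNIV. Vx t x (axis i 1) $ i) = 0)
     \<and> (\<forall>t\<in>{0..T}. \<forall>x. (q t has_derivative Q t x) (at x))
     \<and> (\<forall>t\<in>{0..T}. \<forall>h. continuous_on UNIV (\<lambda>x. Q t x h))
     \<and> (\<forall>t\<in>{0..T}. \<forall>x i. Vt t x $ i + Vx t x (v t x) $ i + Q t x (axis i 1) = 0)"

lemma classical_Euler_derivatives:
  fixes v :: "real \<Rightarrow> real ^ 3 \<Rightarrow> real ^ 3"
  assumes T: "T > 0" and v: "classical_Euler T u0 v"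
  shows "\<exists>Vt Vx q Q. Euler_derivatives T v Vt Vx q Q"
proof -
  let ?S = "{0..T} \<times> (UNIV :: (real ^ 3) set)"
  let ?V = "\<lambda>(t, x). v t x"
  define D where "D p = frechet_derivative ?V (at p within ?S)" for p
  have C1: "C_on (Suc 0) ?S ?V"
    and per: "\<And>t. t \<in> {0..T} \<Longrightarrow> periodic (v t)"
    and dv: "\<And>t x. t \<in> {0..T} \<Longrightarrow> div_field (v t) x = 0"
    using v unfolding classical_Euler_def One_nat_def by blast+
  obtain q where "\<forall>t\<in>{0..T}. periodic (q t) \<and> C_on 1 UNIV (q t)
      \<and> (\<forall>x. vector_derivative (\<lambda>s. v s x) (at t within {0..T}) + Jac (v t) x *v v t x + grad (q t) x = 0)"
    using v unfolding classical_Euler_def by blast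
  then have q: "\<And>t. t \<in> {0..T} \<Longrightarrow> periodic (q t)" "\<And>t. t \<in> {0..T} \<Longrightarrow> C_on 1 UNIV (q t)"
    and eq: "\<And>t x. t \<in> {0..T} \<Longrightarrow> vector_derivative (\<lambda>s. v s x) (at t within {0..T})
                       + Jac (v t) x *v v t x + grad (q t) x = 0"
    by blast+
  have der: "(?V has_derivative D p) (at p within ?S)" if "p \<in> ?S" for p
    unfolding D_def by (rule C_on_has_derivative[OF C1 that])
  have cont: "continuous_on ?S (\<lambda>p. D p h)" for h
    using C1 unfolding C_on.simps D_def by blast
  have derx: "(v t has_derivative (\<lambda>h. D (t, x) (0, h))) (at x)" if t: "t \<in> {0..T}" for t x
  proof -
    have d: "((\<lambda>x. (t, x)) has_derivative (\<lambda>h. (0, h))) (at x)"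
      by (auto intro!: derivative_eq_intros)
    have "((\<lambda>x. ?V (t, x)) has_derivative (\<lambda>h. D (t, x) (0, h))) (at x within UNIV)"
      by (rule has_derivative_in_compose2[of ?S ?V D "\<lambda>x. (t, x)" UNIV, OF der _ _ d]) (use t in auto)
    then show ?thesis by simp
  qed
  have dert: "((\<lambda>s. v s x) has_vector_derivative D (t, x) (1, 0)) (at t within {0..T})"
    if t: "t \<in> {0..T}" for t x
  proof -
    have d: "((\<lambda>s. (s, x)) has_derivative (\<lambda>h. (h, 0))) (at t within {0..T})"
      by (auto intro!: derivative_eq_intros)
    have 1: "((\<lambda>s. ?V (s, x)) has_derivative (\<lambda>h. D (t, x) (h, 0))) (at t within {0..T})"
      by (rule has_derivative_in_compose2[of ?S ?V D "\<lambda>s. (s, x)" "{0..T}", OF der _ _ d]) (use t in auto)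
    have "linear (D (t, x))"
      using t by (intro has_derivative_linear[OF der]) simp
    then have "D (t, x) (h, 0) = h *\<^sub>R D (t, x) (1, 0)" for h
      using linear_cmul[of "D (t, x)" h "(1, 0)"] by simp
    then have "(\<lambda>h. D (t, x) (h, 0)) = (\<lambda>h. h *\<^sub>R D (t, x) (1, 0))" by (rule ext)
    then show ?thesis using 1 by (simp only: has_vector_derivative_def prod.case)
  qed
  have qder: "(q t has_derivative frechet_derivative (q t) (at x)) (at x)" if "t \<in> {0..T}" for t x
    using C_on_has_derivative[of 0 UNIV "q t" x] q(2)[OF that] by (simp only: One_nat_def UNIV_I)
  have "continuous_on ?S ?V"
    using C1 by (auto intro!: differentiable_imp_continuous_on)
  moreover have "continuous_on ?S (\<lambda>(t, x). D (t, x) h)" for h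
    using cont[of h] by (simp add: case_prod_beta)
  then have "continuous_on ?S (\<lambda>(t, x). D (t, x) (1, 0))"
    "\<forall>h. continuous_on ?S (\<lambda>(t, x). D (t, x) (0, h))" by blast+
  moreover have "(\<Sum>i\<in>UNIV. D (t, x) (0, axis i 1) $ i) = 0" if "t \<in> {0..T}" for t x
    using div_field_eq[OF derx[OF that]] dv[OF that] by simp
  moreover have "continuous_on UNIV (\<lambda>x. frechet_derivative (q t) (at x) h)" if "t \<in> {0..T}" for t h
    using q(2)[OF that] by simp
  moreover have "D (t, x) (1, 0) $ i + D (t, x) (0, v t x) $ i + frechet_derivative (q t) (at x) (axis i 1) = 0"
    if t: "t \<in> {0..T}" for t x i
  proof -
    have "vector_derivative (\<lambda>s. v s x) (at t within {0..T}) = D (t, x) (1, 0)"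
      using T t dert[OF t, of x] vector_derivative_within_cbox[of 0 T t "\<lambda>s. v s x" "D (t, x) (1, 0)"] by simp
    moreover have "Jac (v t) x *v v t x = D (t, x) (0, v t x)"
    proof -
      have "Jac (v t) x = matrix (\<lambda>h. D (t, x) (0, h))"
        unfolding Jac_def jacobian_def by (simp add: frechet_derivative_at[OF derx[OF t, of x], symmetric])
      then show ?thesis
        using fun_cong[OF matrix_vector_mul(2)[OF has_derivative_linear[OF derx[OF t, of x]]], of "v t x"]
        by simp
    qed
    ultimately have "(D (t, x) (1, 0) + D (t, x) (0, v t x) + grad (q t) x) $ i = 0"
      using eq[OF t, of x] by simp
    then show ?thesis by (simp add: grad_def partial_def)
  qed
  ultimately have "Euler_derivatives T v (\<lambda>t x. D (t, x) (1, 0)) (\<lambda>t x h. D (t, x) (0, h)) q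
      (\<lambda>t x. frechet_derivative (q t) (at x))"
    unfolding Euler_derivatives_def using per q(1) derx dert qder by (intro conjI ballI allI) simp_all
  then show ?thesis by blast
qed

lemma linear_axis_expand:
  fixes L :: "real ^ 3 \<Rightarrow> 'b::real_vector"
  assumes "linear L" shows "L h = (\<Sum>i\<in>UNIV. h $ i *\<^sub>R L (axis i 1))"
proof -
  have "L h = L (\<Sum>i\<in>UNIV. h $ i *s axis i 1)" by (simp only: basis_expansion)
  then show ?thesis using assms by (simp add: linear_sum linear_cmul scalar_mult_eq_scaleR)
qed

text \<open>
  No sign of the constant \<open>M\<close> is needed: $F e^{-Mt}$ is nonincreasing.
\<close>

lemma Gronwall_zero:
  fixes F :: "real \<Rightarrow> real"
  assumes der: "\<And>t. t \<in> {0..T} \<Longrightarrow> (F has_real_derivative F' t) (at t within {0..T})"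
    and le: "\<And>t. t \<in> {0..T} \<Longrightarrow> F' t \<le> M * F t"
    and F0: "F 0 = 0" and nonneg: "\<And>t. t \<in> {0..T} \<Longrightarrow> F t \<ge> 0" and t: "t \<in> {0..T}"
  shows "F t = 0"
proof -
  let ?E = "\<lambda>t. F t * exp (- M * t)"
  have dE: "(?E has_real_derivative (F' s - M * F s) * exp (- M * s)) (at s within {0..T})"
    if "s \<in> {0..T}" for s
  proof -
    have "((\<lambda>s. exp (- M * s)) has_real_derivative (- M) * exp (- M * s)) (at s within {0..T})"
      by (auto intro!: derivative_eq_intros)
    from DERIV_mult[OF der[OF that] this] show ?thesis by (simp add: algebra_simps)
  qed
  have "?E t \<le> ?E 0"
  proof (rule DERIV_nonpos_imp_decreasing_open[of 0 t ?E])
    fix s assume s: "0 < s" "s < t"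
    then have "(?E has_real_derivative (F' s - M * F s) * exp (- M * s)) (at s)"
      using dE[of s] t by (simp add: at_within_Icc_at)
    moreover have "(F' s - M * F s) * exp (- M * s) \<le> 0"
      using le[of s] s t by (intro mult_nonpos_nonneg) auto
    ultimately show "\<exists>y. (?E has_real_derivative y) (at s) \<and> y \<le> 0" by blast
  next
    show "continuous_on {0..t} ?E"
    proof (rule DERIV_continuous_on)
      fix s assume "s \<in> {0..t}"
      then show "(?E has_real_derivative (F' s - M * F s) * exp (- M * s)) (at s within {0..t})"
        using t by (intro DERIV_subset[OF dE]) auto
    qed
  qed (use t in auto)
  then have "F t \<le> 0" using F0 by (simp add: mult_le_0_iff)
  then show ?thesis using nonneg[OF t] by simp
qed

text \<open>
  Energy method. For the difference $z = w - v$ and the pressure difference $\pi$,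
  $\frac{d}{dt}|z|^2 = - 2 z\cdot(z\cdot\nabla)v - \nabla\cdot(|z|^2 w + 2\pi z)$, the divergence
  integrates to zero, and the first term is controlled by the maximum of $|\nabla v|$ on the compact
  cylinder. Gronwall's inequality gives $z = 0$.
\<close>

proposition classical_Euler_unique:
  assumes T: "T > 0" and v: "classical_Euler T u0 v" and w: "classical_Euler T u0 w"
    and t: "t \<in> {0..T}"
  shows "w t x = v t x"
proof -
  let ?S = "{0..T} \<times> (UNIV :: (real ^ 3) set)"
  let ?Q = "cbox 0 One :: (real ^ 3) set"
  obtain Vt Vx q Q where Ev: "Euler_derivatives T v Vt Vx q Q"
    using classical_Euler_derivatives[OF T v] by blast
  have v_cont: "continuous_on ?S (\<lambda>(t, x). v t x)" "continuous_on ?S (\<lambda>(t, x). Vt t x)"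
      "\<And>h. continuous_on ?S (\<lambda>(t, x). Vx t x h)"
    and v_t: "\<And>t x. t \<in> {0..T} \<Longrightarrow> ((\<lambda>s. v s x) has_vector_derivative Vt t x) (at t within {0..T})"
    and v_x: "\<And>t x. t \<in> {0..T} \<Longrightarrow> (v t has_derivative Vx t x) (at x)"
    and v_per: "\<And>t. t \<in> {0..T} \<Longrightarrow> periodic (v t)"
    and q_per: "\<And>t. t \<in> {0..T} \<Longrightarrow> periodic (q t)"
    and v_div: "\<And>t x. t \<in> {0..T} \<Longrightarrow> (\<Sum>i\<in>UNIV. Vx t x (axis i 1) $ i) = 0"
    and q_x: "\<And>t x. t \<in> {0..T} \<Longrightarrow> (q t has_derivative Q t x) (at x)"
    and q_cont: "\<And>t h. t \<in> {0..T} \<Longrightarrow> continuous_on UNIV (\<lambda>x. Q t x h)"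
    and v_eq: "\<And>t x i. t \<in> {0..T} \<Longrightarrow> Vt t x $ i + Vx t x (v t x) $ i + Q t x (axis i 1) = 0"
    using Ev unfolding Euler_derivatives_def by blast+
  have v_0: "AE x in torus. v 0 x = u0 x"
    using v unfolding classical_Euler_def by blast
  obtain Wt Wx r R where Ew: "Euler_derivatives T w Wt Wx r R"
    using classical_Euler_derivatives[OF T w] by blast
  have w_cont: "continuous_on ?S (\<lambda>(t, x). w t x)" "continuous_on ?S (\<lambda>(t, x). Wt t x)"
      "\<And>h. continuous_on ?S (\<lambda>(t, x). Wx t x h)"
    and w_t: "\<And>t x. t \<in> {0..T} \<Longrightarrow> ((\<lambda>s. w s x) has_vector_derivative Wt t x) (at t within {0..T})"
    and w_x: "\<And>t x. t \<in> {0..T} \<Longrightarrow> (w t has_derivative Wx t x) (at x)"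
    and w_per: "\<And>t. t \<in> {0..T} \<Longrightarrow> periodic (w t)"
    and r_per: "\<And>t. t \<in> {0..T} \<Longrightarrow> periodic (r t)"
    and w_div: "\<And>t x. t \<in> {0..T} \<Longrightarrow> (\<Sum>i\<in>UNIV. Wx t x (axis i 1) $ i) = 0"
    and r_x: "\<And>t x. t \<in> {0..T} \<Longrightarrow> (r t has_derivative R t x) (at x)"
    and r_cont: "\<And>t h. t \<in> {0..T} \<Longrightarrow> continuous_on UNIV (\<lambda>x. R t x h)"
    and w_eq: "\<And>t x i. t \<in> {0..T} \<Longrightarrow> Wt t x $ i + Wx t x (w t x) $ i + R t x (axis i 1) = 0"
    using Ew unfolding Euler_derivatives_def by blast+
  have w_0: "AE x in torus. w 0 x = u0 x"
    using w unfolding classical_Euler_def by blast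
  have slice: "continuous_on UNIV (\<lambda>x. f t x)" if "continuous_on ?S (\<lambda>(t, x). f t x)" "t \<in> {0..T}"
    for f :: "real \<Rightarrow> real ^ 3 \<Rightarrow> real ^ 3" and t
  proof -
    have "continuous_on UNIV (\<lambda>x. (case (t, x) of (t, x) \<Rightarrow> f t x))"
      using that(2) by (intro continuous_on_compose2[OF that(1), of UNIV "\<lambda>x. (t, x)"] continuous_intros) auto
    then show ?thesis by simp
  qed
  define z where "z = (\<lambda>t x. w t x - v t x)"
  define F where "F = (\<lambda>t. integral ?Q (\<lambda>x. z t x \<bullet> z t x))"
  have z_cont: "continuous_on UNIV (z t)" if "t \<in> {0..T}" for t
    unfolding z_def by (intro continuous_intros slice v_cont w_cont that)
  have z_per: "periodic (z t)" if "t \<in> {0..T}" for t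
    using v_per[OF that] w_per[OF that] by (simp add: periodic_def z_def)
  have F_der: "(F has_real_derivative integral ?Q (\<lambda>x. 2 * (z t x \<bullet> (Wt t x - Vt t x)))) (at t within {0..T})"
    if t: "t \<in> {0..T}" for t
    unfolding F_def has_real_derivative_iff_has_vector_derivative
  proof (rule leibniz_rule_vector_derivative)
    fix s x assume s: "s \<in> {0..T}"
    have "((\<lambda>s. z s x) has_vector_derivative (Wt s x - Vt s x)) (at s within {0..T})"
      unfolding z_def by (intro has_vector_derivative_diff v_t w_t s)
    then have d: "((\<lambda>s. z s x) has_derivative (\<lambda>h. h *\<^sub>R (Wt s x - Vt s x))) (at s within {0..T})"
      by (simp only: has_vector_derivative_def)
    show "((\<lambda>s. z s x \<bullet> z s x) has_vector_derivative 2 * (z s x \<bullet> (Wt s x - Vt s x))) (at s within {0..T})"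
      unfolding has_vector_derivative_def
      by (rule has_derivative_eq_rhs[OF has_derivative_inner[OF d d]])
        (auto simp: inner_commute[of _ "z s x"] algebra_simps)
  next
    fix s assume "s \<in> {0..T}"
    then show "(\<lambda>x. z s x \<bullet> z s x) integrable_on ?Q"
      by (intro integrable_continuous continuous_intros continuous_on_subset[OF z_cont]) auto
  next
    have "continuous_on ?S (\<lambda>p. 2 * ((w (fst p) (snd p) - v (fst p) (snd p)) \<bullet> (Wt (fst p) (snd p) - Vt (fst p) (snd p))))"
      using v_cont(1,2) w_cont(1,2) by (intro continuous_intros) (simp_all add: case_prod_beta)
    then show "continuous_on ({0..T} \<times> ?Q) (\<lambda>(s, x). 2 * (z s x \<bullet> (Wt s x - Vt s x)))"
      unfolding z_def case_prod_beta by (rule continuous_on_subset) auto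
  qed (use t in auto)
  have "\<exists>M\<ge>0. \<forall>t\<in>{0..T}. \<forall>x\<in>?Q. norm (Vx t x (axis i 1)) \<le> M" for i
  proof -
    have "compact ((\<lambda>(t, x). Vx t x (axis i 1)) ` ({0..T} \<times> ?Q))"
      by (intro compact_continuous_image continuous_on_subset[OF v_cont(3)] compact_Times) auto
    then obtain M where "M > 0" "\<forall>y \<in> (\<lambda>(t, x). Vx t x (axis i 1)) ` ({0..T} \<times> ?Q). norm y \<le> M"
      using bounded_pos compact_imp_bounded by metis
    then show ?thesis by (intro exI[of _ M]) auto
  qed
  then have "\<forall>i. \<exists>M. M \<ge> 0 \<and> (\<forall>t\<in>{0..T}. \<forall>x\<in>?Q. norm (Vx t x (axis i 1)) \<le> M)" by blast
  then have "\<exists>M. \<forall>i. M i \<ge> 0 \<and> (\<forall>t\<in>{0..T}. \<forall>x\<in>?Q. norm (Vx t x (axis i 1)) \<le> M i)"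
    by (rule choice)
  then obtain M where M: "\<And>i. M i \<ge> 0" "\<And>i t x. t \<in> {0..T} \<Longrightarrow> x \<in> ?Q \<Longrightarrow> norm (Vx t x (axis i 1)) \<le> M i"
    by blast
  define K where "K = (\<Sum>i\<in>UNIV. M i)"
  have VxK: "norm (Vx t x h) \<le> K * norm h" if "t \<in> {0..T}" "x \<in> ?Q" for t x h
  proof -
    have "Vx t x h = (\<Sum>i\<in>UNIV. h $ i *\<^sub>R Vx t x (axis i 1))"
      using has_derivative_linear[OF v_x[OF that(1)]] by (rule linear_axis_expand)
    also have "norm \<dots> \<le> (\<Sum>i\<in>UNIV. norm (h $ i *\<^sub>R Vx t x (axis i 1)))" by (rule norm_sum)
    also have "\<dots> \<le> (\<Sum>i\<in>UNIV. norm h * M i)"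
      using M that by (auto intro!: sum_mono mult_mono component_le_norm_cart)
    also have "\<dots> = K * norm h" by (simp add: K_def sum_distrib_left mult.commute)
    finally show ?thesis .
  qed
  have F_le: "integral ?Q (\<lambda>x. 2 * (z t x \<bullet> (Wt t x - Vt t x))) \<le> (2 * K) * F t"
    if t: "t \<in> {0..T}" for t
  proof -
    let ?Z = "\<lambda>x h. Wx t x h - Vx t x h"
    let ?P = "\<lambda>x h. R t x h - Q t x h"
    \<comment> \<open>\<open>?G\<close> is the derivative of the field $|z|^2 w + 2(r - q)z$.\<close>
    let ?G = "\<lambda>x h. ((z t x \<bullet> z t x) *\<^sub>R Wx t x h + (z t x \<bullet> ?Z x h + ?Z x h \<bullet> z t x) *\<^sub>R w t x)
       + 2 *\<^sub>R ((r t x - q t x) *\<^sub>R ?Z x h + ?P x h *\<^sub>R z t x)"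
    have z_x: "(z t has_derivative ?Z x) (at x)" for x
      unfolding z_def by (intro has_derivative_diff v_x w_x t)
    have cs: "continuous_on UNIV (\<lambda>x. Vx t x h)" "continuous_on UNIV (\<lambda>x. Wx t x h)"
        "continuous_on UNIV (w t)" "continuous_on UNIV (Vt t)" "continuous_on UNIV (Wt t)" for h
      by (rule slice[OF _ t], fact)+
    have cp: "continuous_on UNIV (\<lambda>x. r t x - q t x)"
      using has_derivative_diff[OF r_x[OF t] q_x[OF t]]
      by (meson continuous_at_imp_continuous_on has_derivative_continuous)
    have cG: "continuous_on UNIV (\<lambda>x. ?G x h)" for h
      by (intro continuous_intros cs cp z_cont r_cont q_cont t)
    have div0: "integral ?Q (\<lambda>x. \<Sum>i\<in>UNIV. ?G x (axis i 1) $ i) = 0"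
    proof (rule integral_torus_divergence_eq_0[OF _ _ cG])
      show "periodic (\<lambda>x. (z t x \<bullet> z t x) *\<^sub>R w t x + 2 *\<^sub>R ((r t x - q t x) *\<^sub>R z t x))"
        using z_per[OF t] w_per[OF t] r_per[OF t] q_per[OF t] by (simp add: periodic_def)
      show "((\<lambda>x. (z t x \<bullet> z t x) *\<^sub>R w t x + 2 *\<^sub>R ((r t x - q t x) *\<^sub>R z t x)) has_derivative ?G x) (at x)" for x
        by (intro has_derivative_add has_derivative_scaleR has_derivative_scaleR_right
            has_derivative_inner has_derivative_diff z_x w_x r_x q_x t)
    qed
    have point: "2 * (z t x \<bullet> (Wt t x - Vt t x)) = - 2 * (z t x \<bullet> Vx t x (z t x)) - (\<Sum>i\<in>UNIV. ?G x (axis i 1) $ i)" for x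
    proof -
      have lin: "linear (Wx t x)" "linear (Vx t x)"
        using has_derivative_linear v_x[OF t] w_x[OF t] by blast+
      have linZ: "linear (?Z x)" by (intro linear_compose_sub lin)
      have "Wt t x - Vt t x = - (Wx t x (w t x) - Vx t x (v t x)) - (\<chi> i. ?P x (axis i 1))"
      proof -
        have "(Wt t x - Vt t x) $ i = (- (Wx t x (w t x) - Vx t x (v t x)) - (\<chi> i. ?P x (axis i 1))) $ i" for i
          using w_eq[OF t, of x i] v_eq[OF t, of x i] by (simp add: algebra_simps)
        then show ?thesis by (rule vec_eq_iff[THEN iffD2, OF allI])
      qed
      also have "Wx t x (w t x) - Vx t x (v t x) = ?Z x (w t x) + Vx t x (z t x)"
        by (simp add: z_def linear_diff[OF lin(2)])
      finally have 1: "z t x \<bullet> (Wt t x - Vt t x)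
          = - (z t x \<bullet> ?Z x (w t x)) - z t x \<bullet> Vx t x (z t x) - (\<Sum>i\<in>UNIV. z t x $ i * ?P x (axis i 1))"
        by (simp add: inner_diff_right inner_add_right inner_minus_right inner_vec_def[of _ "vec_lambda _"])
      have 2: "z t x \<bullet> ?Z x (w t x) = (\<Sum>i\<in>UNIV. w t x $ i * (z t x \<bullet> ?Z x (axis i 1)))"
        by (subst linear_axis_expand[OF linZ]) (simp only: inner_sum_right inner_scaleR_right)
      have divz: "(\<Sum>i\<in>UNIV. ?Z x (axis i 1) $ i) = 0"
        using w_div[OF t, of x] v_div[OF t, of x] by (simp add: sum_subtractf)
      have "(\<Sum>i\<in>UNIV. ?G x (axis i 1) $ i)
        = (z t x \<bullet> z t x) * (\<Sum>i\<in>UNIV. Wx t x (axis i 1) $ i)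
          + 2 * (\<Sum>i\<in>UNIV. w t x $ i * (z t x \<bullet> ?Z x (axis i 1)))
          + 2 * ((r t x - q t x) * (\<Sum>i\<in>UNIV. ?Z x (axis i 1) $ i))
          + 2 * (\<Sum>i\<in>UNIV. z t x $ i * ?P x (axis i 1))"
      proof -
        have "?G x (axis i 1) $ i = (z t x \<bullet> z t x) * Wx t x (axis i 1) $ i
            + 2 * (w t x $ i * (z t x \<bullet> ?Z x (axis i 1)))
            + 2 * ((r t x - q t x) * ?Z x (axis i 1) $ i) + 2 * (z t x $ i * ?P x (axis i 1))" for i
          by (simp add: inner_commute[of "Wx t x _" "z t x"] inner_commute[of "Vx t x _" "z t x"] algebra_simps)
        then show ?thesis unfolding sum_distrib_left sum.distrib[symmetric] by (rule sum.cong[OF refl])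
      qed
      then have 3: "(\<Sum>i\<in>UNIV. ?G x (axis i 1) $ i) = 2 * (\<Sum>i\<in>UNIV. w t x $ i * (z t x \<bullet> ?Z x (axis i 1)))
          + 2 * (\<Sum>i\<in>UNIV. z t x $ i * ?P x (axis i 1))"
        by (simp only: w_div[OF t] divz mult_zero_right add_0_left add_0_right)
      have alg: "2 * (- a - b - c) = - 2 * b - (2 * a + 2 * c)" for a b c :: real by simp
      show ?thesis
        unfolding 1 2 3 by (rule alg)
    qed
    have cd: "continuous_on UNIV (\<lambda>x. \<Sum>i\<in>UNIV. ?G x (axis i 1) $ i)"
      by (intro continuous_intros cG)
    have linear_z: "continuous_on UNIV (\<lambda>x. z t x \<bullet> Vx t x (z t x))"
    proof -
      have "Vx t x (z t x) = (\<Sum>i\<in>UNIV. z t x $ i *\<^sub>R Vx t x (axis i 1))" for x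
        by (rule linear_axis_expand[OF has_derivative_linear[OF v_x[OF t]]])
      moreover have "continuous_on UNIV (\<lambda>x. z t x \<bullet> (\<Sum>i\<in>UNIV. z t x $ i *\<^sub>R Vx t x (axis i 1)))"
        by (intro continuous_intros z_cont cs t)
      ultimately show ?thesis by (simp cong: continuous_on_cong)
    qed
    have "integral ?Q (\<lambda>x. 2 * (z t x \<bullet> (Wt t x - Vt t x)))
        = integral ?Q (\<lambda>x. - 2 * (z t x \<bullet> Vx t x (z t x))) - integral ?Q (\<lambda>x. \<Sum>i\<in>UNIV. ?G x (axis i 1) $ i)"
      unfolding point
      by (intro Henstock_Kurzweil_Integration.integral_diff integrable_continuous continuous_on_mult_left
          continuous_on_subset[OF linear_z] continuous_on_subset[OF cd]) auto
    also have "\<dots> = integral ?Q (\<lambda>x. - 2 * (z t x \<bullet> Vx t x (z t x)))"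
      unfolding div0 by simp
    also have "\<dots> \<le> integral ?Q (\<lambda>x. (2 * K) * (z t x \<bullet> z t x))"
    proof (rule integral_le)
      show "(\<lambda>x. - 2 * (z t x \<bullet> Vx t x (z t x))) integrable_on ?Q"
        by (intro integrable_continuous continuous_on_mult_left continuous_on_subset[OF linear_z]) auto
      show "(\<lambda>x. (2 * K) * (z t x \<bullet> z t x)) integrable_on ?Q"
        by (intro integrable_continuous continuous_on_mult_left continuous_on_inner
            continuous_on_subset[OF z_cont[OF t]]) auto
      fix x assume x: "x \<in> ?Q"
      have "\<bar>z t x \<bullet> Vx t x (z t x)\<bar> \<le> norm (z t x) * norm (Vx t x (z t x))"
        by (rule Cauchy_Schwarz_ineq2)
      also have "\<dots> \<le> norm (z t x) * (K * norm (z t x))"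
        by (intro mult_left_mono VxK t x) auto
      also have "\<dots> = K * (z t x \<bullet> z t x)"
        by (simp add: power2_eq_square flip: power2_norm_eq_inner)
      finally show "- 2 * (z t x \<bullet> Vx t x (z t x)) \<le> (2 * K) * (z t x \<bullet> z t x)" by linarith
    qed
    also have "\<dots> = (2 * K) * F t" by (simp add: F_def)
    finally show ?thesis .
  qed
  have zz: "continuous_on UNIV (\<lambda>x. z t x \<bullet> z t x)" if "t \<in> {0..T}" for t
    by (intro continuous_intros z_cont that)
  have "F 0 = (LINT x|torus. z 0 x \<bullet> z 0 x)"
    unfolding F_def using T by (simp add: integral_torus_continuous zz)
  also have "\<dots> = 0"
    by (rule integral_eq_zero_AE) (use v_0 w_0 in eventually_elim, simp add: z_def)
  finally have F0: "F 0 = 0" .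
  have F_nonneg: "F s \<ge> 0" if "s \<in> {0..T}" for s
    unfolding F_def
    by (rule Henstock_Kurzweil_Integration.integral_nonneg[OF integrable_continuous[OF continuous_on_subset[OF zz[OF that]]]])
      simp_all
  have "F t = 0"
    by (rule Gronwall_zero[OF F_der F_le F0 F_nonneg t])
  moreover have "F t = 0 \<longleftrightarrow> (\<forall>x\<in>?Q. z t x \<bullet> z t x = 0)"
    unfolding F_def
  proof (rule integral_cbox_eq_0_iff)
    show "continuous_on ?Q (\<lambda>x. z t x \<bullet> z t x)" by (rule continuous_on_subset[OF zz[OF t]]) simp
    show "box 0 (One :: real ^ 3) \<noteq> {}" by (simp add: box_ne_empty)
  qed simp
  ultimately have "\<forall>x\<in>?Q. z t x \<bullet> z t x = 0" by blast
  then have "\<And>y. y \<in> ?Q \<Longrightarrow> z t y = 0" by (simp only: inner_eq_zero_iff)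
  then have "z t x = 0"
    by (rule periodic_eq_0_if_on_cube[OF z_per[OF t]])
  then show ?thesis by (simp add: z_def)
qed

section \<open>Measurability and null sets\<close>

text \<open>
  In a completed measure space measurability is insensitive to null sets. This allows integrands
  known only almost everywhere to be replaced without checking their measurability.
\<close>

lemma borel_measurable_completion_AE_eq:
  fixes f g :: "'a \<Rightarrow> 'b::topological_space"
  assumes g: "g \<in> borel_measurable (completion M)" and eq: "AE x in completion M. f x = g x"
  shows "f \<in> borel_measurable (completion M)"
proof (rule measurableI)
  fix A :: "'b set" assume A: "A \<in> sets borel"
  show "f -` A \<inter> space (completion M) \<in> sets (completion M)"
  proof (rule completion.in_sets_AE)
    show "g -` A \<inter> space (completion M) \<in> sets (completion M)" using g A by (rule measurable_sets)
    show "AE x in completion M. (x \<in> g -` A \<inter> space (completion M)) = (x \<in> f -` A \<inter> space (completion M))"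
      using eq by eventually_elim auto
  qed auto
qed auto

lemma AE_lebesgue_on_iff:
  assumes "S \<in> sets borel"
  shows "(AE x in lebesgue_on S. P x) \<longleftrightarrow> (AE x in lborel. x \<in> S \<longrightarrow> P x)"
  using assms by (subst AE_restrict_space_iff) (auto simp: AE_completion_iff)

lemma integral_lebesgue_on_eq_borel:
  fixes f g :: "'a::euclidean_space \<Rightarrow> 'b::euclidean_space"
  assumes S: "S \<in> sets borel" and g: "g \<in> borel_measurable borel"
    and eq: "AE x in lebesgue_on S. f x = g x"
  shows "(LINT x|lebesgue_on S. f x) = (LINT x|lborel. indicator S x *\<^sub>R g x)"
proof -
  have gm: "(\<lambda>x. indicator S x *\<^sub>R g x) \<in> borel_measurable borel" using S g by simp
  have ae: "AE x in lebesgue. indicator S x *\<^sub>R f x = indicator S x *\<^sub>R g x"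
    using eq unfolding AE_lebesgue_on_iff[OF S] AE_completion_iff
    by eventually_elim (auto simp: indicator_def)
  have gl: "(\<lambda>x. indicator S x *\<^sub>R g x) \<in> borel_measurable lebesgue"
    using gm by (intro measurable_completion) simp
  have "(LINT x|lebesgue_on S. f x) = (LINT x|lebesgue. indicator S x *\<^sub>R f x)"
    using S by (intro integral_restrict_space) auto
  also have "\<dots> = (LINT x|lebesgue. indicator S x *\<^sub>R g x)"
    by (intro integral_cong_AE borel_measurable_completion_AE_eq[OF gl ae] gl ae)
  also have "\<dots> = (LINT x|lborel. indicator S x *\<^sub>R g x)"
    using gm by (intro integral_completion) simp
  finally show ?thesis .
qed

text \<open>
  A Lebesgue measurable field on the slab agrees almost everywhere with a Borel one, to which
  Fubini's theorem for the product of Borel measures applies.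
\<close>

lemma Borel_representative:
  fixes u :: "real \<Rightarrow> real ^ 3 \<Rightarrow> real ^ 3"
  assumes m: "(\<lambda>(t, x). u t x) \<in> borel_measurable (lebesgue_on ({0<..<T} \<times> UNIV))"
  obtains U where "U \<in> borel_measurable borel"
    "AE p in lborel. fst p \<in> {0<..<T} \<longrightarrow> u (fst p) (snd p) = U p"
proof -
  let ?S = "{0<..<T} \<times> (UNIV :: (real ^ 3) set)"
  have S: "?S \<in> sets borel" by (intro borel_open open_Times) auto
  let ?G = "\<lambda>p. if p \<in> ?S then (case p of (t, x) \<Rightarrow> u t x) else 0"
  have G: "?G \<in> borel_measurable lebesgue"
    using S by (intro borel_measurable_if_I m) auto
  have "\<exists>g\<in>borel_measurable lborel. AE p in lborel. ?G p \<bullet> axis i 1 = g p" for i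
    using G by (intro completion_ex_borel_measurable_real borel_measurable_inner) auto
  then have "\<forall>i. \<exists>g. g \<in> borel_measurable lborel \<and> (AE p in lborel. ?G p \<bullet> axis i 1 = g p)" by blast
  then have "\<exists>g. \<forall>i. g i \<in> borel_measurable lborel \<and> (AE p in lborel. ?G p \<bullet> axis i 1 = g i p)"
    by (rule choice)
  then obtain g where g: "\<And>i. g i \<in> borel_measurable lborel" "\<And>i. AE p in lborel. ?G p \<bullet> axis i 1 = g i p"
    by blast
  define U where "U = (\<lambda>p. \<Sum>i\<in>UNIV. g i p *\<^sub>R axis i (1::real))"
  have "U \<in> borel_measurable borel"
    unfolding U_def using g(1) by (intro borel_measurable_sum borel_measurable_scaleR) auto
  moreover have "AE p in lborel. \<forall>i\<in>UNIV. ?G p \<bullet> axis i 1 = g i p"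
    by (rule AE_finite_allI) (use g(2) in auto)
  then have "AE p in lborel. fst p \<in> {0<..<T} \<longrightarrow> u (fst p) (snd p) = U p"
  proof eventually_elim
    case (elim p)
    show ?case
    proof
      assume "fst p \<in> {0<..<T}"
      then have "u (fst p) (snd p) = ?G p" by (auto simp: mem_Times_iff case_prod_beta)
      also have "\<dots> = (\<Sum>i\<in>UNIV. (?G p $ i) *\<^sub>R axis i 1)"
        using basis_expansion[of "?G p"] by (simp only: scalar_mult_eq_scaleR)
      also have "\<dots> = U p"
        unfolding U_def using elim by (intro sum.cong refl) (simp only: inner_axis inner_real_def mult_1_right UNIV_I ball_simps)
      finally show "u (fst p) (snd p) = U p" .
    qed
  qed
  ultimately show ?thesis by (rule that)
qed

text \<open>
  The positive and the negative part of \<open>h\<close> define finite measures that agree on all half-lines,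
  hence are equal, and so are their densities.
\<close>

lemma AE_eq_0_if_initial_integrals_eq_0:
  fixes h :: "real \<Rightarrow> real"
  assumes T: "T > 0" and int: "integrable lborel (\<lambda>t. indicator {0<..<T} t * h t)"
    and zero: "\<And>c. c \<in> {0<..<T} \<Longrightarrow> (LINT t|lborel. indicator {0<..<c} t * h t) = 0"
  shows "AE t in lborel. t \<in> {0<..<T} \<longrightarrow> h t = 0"
proof -
  let ?k = "\<lambda>t. indicator {0<..<T} t * h t"
  have km: "?k \<in> borel_measurable borel" using borel_measurable_integrable[OF int] by simp
  have zero': "(LINT t|lborel. indicator {0<..<c} t * ?k t) = 0" if "c \<in> {0<..<T}" for c
    using zero[OF that] that
    by (intro trans[OF Bochner_Integration.integral_cong zero[OF that]]) (auto simp: indicator_def)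
  have total: "(LINT t|lborel. ?k t) = 0"
  proof (rule LIMSEQ_unique)
    let ?c = "\<lambda>n. T - T / (real n + 2)"
    have c: "?c n \<in> {0<..<T}" for n
      using T by (auto simp: field_simps intro: add_pos_nonneg)
    show "(\<lambda>n. LINT t|lborel. indicator {0<..<?c n} t * ?k t) \<longlonglongrightarrow> (LINT t|lborel. ?k t)"
    proof (rule integral_dominated_convergence[where w = "\<lambda>t. \<bar>?k t\<bar>"])
      have cT: "?c \<longlonglongrightarrow> T" by real_asymp
      show "AE t in lborel. (\<lambda>n. indicator {0<..<?c n} t * ?k t) \<longlonglongrightarrow> ?k t"
      proof (rule AE_I2)
        fix t
        show "(\<lambda>n. indicator {0<..<?c n} t * ?k t) \<longlonglongrightarrow> ?k t"
        proof (cases "t \<in> {0<..<T}")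
          case True
          then have "eventually (\<lambda>n. t < ?c n) sequentially"
            using order_tendstoD(1)[OF cT, of t] by simp
          then have "eventually (\<lambda>n. indicator {0<..<?c n} t * ?k t = ?k t) sequentially"
            using True by (auto elim!: eventually_mono simp: indicator_def)
          then show ?thesis by (rule tendsto_eventually)
        qed simp
      qed
    qed (use km int in \<open>auto simp: indicator_def integrable_abs\<close>)
    show "(\<lambda>n. LINT t|lborel. indicator {0<..<?c n} t * ?k t) \<longlonglongrightarrow> 0"
      by (simp only: zero'[OF c] tendsto_const)
  qed
  have tail: "(LINT t|lborel. indicator {x<..} t * ?k t) = 0" for x
  proof -
    have int': "integrable lborel (\<lambda>t. indicator A t * ?k t)" if "A \<in> sets borel" for A
      using integrable_mult_indicator[OF _ int, of A] that by simp
    consider "x \<le> 0" | "x \<in> {0<..<T}" | "x \<ge> T" by fastforce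
    then show ?thesis
    proof cases
      case 1
      then have "(\<lambda>t. indicator {x<..} t * ?k t) = ?k" by (auto simp: indicator_def)
      then show ?thesis using total by (simp only:)
    next
      case 2
      have "(LINT t|lborel. indicator {x<..} t * ?k t) = (LINT t|lborel. ?k t - indicator {0<..<x} t * ?k t)"
      proof (rule integral_cong_AE)
        show "AE t in lborel. indicator {x<..} t * ?k t = ?k t - indicator {0<..<x} t * ?k t"
          using AE_lborel_singleton[of x] by eventually_elim (auto simp: indicator_def)
      qed (use km in simp_all)
      also have "\<dots> = 0"
        using int int'[of "{0<..<x}"] total zero'[OF 2] by (subst Bochner_Integration.integral_diff) auto
      finally show ?thesis .
    next
      case 3
      then have "(\<lambda>t. indicator {x<..} t * ?k t) = (\<lambda>t. 0)" by (auto simp: indicator_def)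
      then show ?thesis by simp
    qed
  qed
  let ?p = "\<lambda>t. max 0 (?k t)" and ?n = "\<lambda>t. max 0 (- ?k t)"
  have ip: "integrable lborel ?p" and inn: "integrable lborel ?n"
    using int by (auto intro!: integrable_max)
  have ipx: "integrable lborel (\<lambda>t. indicator {x<..} t * ?p t)" and inx: "integrable lborel (\<lambda>t. indicator {x<..} t * ?n t)" for x
    using integrable_mult_indicator[OF _ ip, of "{x<..}"] integrable_mult_indicator[OF _ inn, of "{x<..}"] by simp_all
  have dens: "emeasure (density lborel (\<lambda>t. ennreal (f t))) {x<..} = ennreal (LINT t|lborel. indicator {x<..} t * f t)"
    if "f \<in> borel_measurable borel" "\<And>t. f t \<ge> 0" "integrable lborel (\<lambda>t. indicator {x<..} t * f t)"
    for f :: "real \<Rightarrow> real" and x :: real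
  proof -
    have "emeasure (density lborel (\<lambda>t. ennreal (f t))) {x<..} = (\<integral>\<^sup>+ t. ennreal (f t) * indicator {x<..} t \<partial>lborel)"
      using that(1) by (intro emeasure_density) auto
    also have "\<dots> = (\<integral>\<^sup>+ t. ennreal (indicator {x<..} t * f t) \<partial>lborel)"
      by (intro nn_integral_cong) (auto simp: indicator_def)
    also have "\<dots> = ennreal (LINT t|lborel. indicator {x<..} t * f t)"
      using that by (intro nn_integral_eq_integral) auto
    finally show ?thesis .
  qed
  have "density lborel (\<lambda>t. ennreal (?p t)) = density lborel (\<lambda>t. ennreal (?n t))"
  proof (rule measure_eqI_lessThan)
    fix x
    have "(LINT t|lborel. indicator {x<..} t * ?p t) - (LINT t|lborel. indicator {x<..} t * ?n t)
        = (LINT t|lborel. indicator {x<..} t * ?p t - indicator {x<..} t * ?n t)"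
      using ipx inx by simp
    also have "\<dots> = (LINT t|lborel. indicator {x<..} t * ?k t)"
      by (intro Bochner_Integration.integral_cong) (auto simp: max_def algebra_simps)
    finally have "(LINT t|lborel. indicator {x<..} t * ?p t) = (LINT t|lborel. indicator {x<..} t * ?n t)"
      using tail by simp
    then show "emeasure (density lborel (\<lambda>t. ennreal (?p t))) {x<..} = emeasure (density lborel (\<lambda>t. ennreal (?n t))) {x<..}"
      using km ipx[of x] inx[of x] by (subst (1 2) dens) auto
    show "emeasure (density lborel (\<lambda>t. ennreal (?p t))) {x<..} < \<infinity>"
      using km ipx[of x] by (subst dens) auto
  qed auto
  then have "AE t in lborel. ennreal (?p t) = ennreal (?n t)"
  proof (subst (asm) finite_density_unique)
    have "(\<integral>\<^sup>+ t. ennreal (?p t) \<partial>lborel) = ennreal (LINT t|lborel. ?p t)"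
      using ip by (intro nn_integral_eq_integral) auto
    then show "(\<integral>\<^sup>+ t. ennreal (?p t) \<partial>lborel) \<noteq> \<infinity>" by simp
  qed (use km in auto)
  then show ?thesis
  proof eventually_elim
    case (elim t)
    then have "?p t = ?n t" by (subst (asm) ennreal_inj) auto
    then show ?case by (auto simp: max_def split: if_splits)
  qed
qed

text \<open>
  Countably many integer translates of the cube cover the space.
\<close>

lemma AE_torus_imp_AE_lborel:
  assumes per: "periodic f" and ae: "AE x in torus. f x = 0"
  shows "AE x in lborel. f x = 0"
proof -
  have Q: "AE x in lborel. x \<in> cbox 0 One \<longrightarrow> f x = 0"
    using ae unfolding torus_def by (rule AE_lebesgue_on_iff[THEN iffD1, rotated]) simp
  have "AE x in lborel. k + x \<in> cbox 0 One \<longrightarrow> f (k + x) = 0" for k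
  proof -
    have "AE x in distr lborel borel ((+) k). x \<in> cbox 0 One \<longrightarrow> f x = 0"
      using Q by (simp only: lborel_distr_plus)
    then show ?thesis by (rule AE_distrD[rotated]) simp
  qed
  then have "AE x in lborel. \<forall>k\<in>freq. k + x \<in> cbox 0 One \<longrightarrow> f (k + x) = 0"
    by (simp add: AE_ball_countable countable_freq)
  then show ?thesis
  proof eventually_elim
    case (elim x)
    obtain k where k: "k \<in> freq" and "k + x \<in> cbox 0 One" by (rule freq_translate_cube)
    then have "f (k + x) = 0" using elim by blast
    moreover have "f (x + k) = f x" using per k unfolding periodic_def freq_def by blast
    ultimately show ?case by (simp add: add.commute)
  qed
qed

section \<open>The solution is stationary\<close>

text \<open>
  The function \<open>flat 0 + flat (- 1)\<close> is the derivative of \<open>flat 1\<close>. It takes values in $[0,2]$ and,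
  rescaled, converges to the indicator function of the positive half-line.
\<close>

lemma flat_sum_bounds:
  "0 \<le> flat 0 y + flat (- 1) y" "flat 0 y + flat (- 1) y \<le> 2"
proof -
  have "flat 0 y + flat (- 1) y = exp (- 1 / y) + inverse y * exp (- 1 / y)" if "y > 0"
    using that by (simp add: flat_def power_int_minus)
  moreover have "exp (- 1 / y) \<le> 1 \<and> 0 \<le> inverse y * exp (- 1 / y) \<and> inverse y * exp (- 1 / y) \<le> 1" if "y > 0"
  proof (intro conjI)
    have "1 / y \<le> exp (1 / y)" using exp_ge_add_one_self[of "1 / y"] by linarith
    then have "1 / y * exp (- 1 / y) \<le> exp (1 / y) * exp (- 1 / y)" by (intro mult_right_mono) auto
    also have "\<dots> = 1" by (simp flip: exp_add)
    finally show "inverse y * exp (- 1 / y) \<le> 1" by (simp add: inverse_eq_divide)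
    show "0 \<le> inverse y * exp (- 1 / y)" using that by simp
  qed (use that in simp)
  moreover have "flat 0 y + flat (- 1) y = 0" if "y \<le> 0"
    using that by (simp add: flat_def)
  moreover have "0 < exp (- 1 / y)" by simp
  ultimately show "0 \<le> flat 0 y + flat (- 1) y" "flat 0 y + flat (- 1) y \<le> 2"
    by (smt (verit))+
qed

lemma flat_sum_tendsto:
  "(\<lambda>n. flat 0 (real (Suc n) * s) + flat (- 1) (real (Suc n) * s)) \<longlonglongrightarrow> (if s > 0 then 1 else 0)"
proof (cases "s > 0")
  case True
  have "((\<lambda>y::real. exp (- 1 / y) + inverse y * exp (- 1 / y)) \<longlongrightarrow> 1) at_top"
    by real_asymp
  moreover have "filterlim (\<lambda>n. real (Suc n) * s) at_top sequentially"
    using True by real_asymp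
  ultimately have "(\<lambda>n. exp (- 1 / (real (Suc n) * s)) + inverse (real (Suc n) * s) * exp (- 1 / (real (Suc n) * s))) \<longlonglongrightarrow> 1"
    by (rule filterlim_compose)
  moreover have "flat 0 (real (Suc n) * s) + flat (- 1) (real (Suc n) * s)
      = exp (- 1 / (real (Suc n) * s)) + inverse (real (Suc n) * s) * exp (- 1 / (real (Suc n) * s))" for n
  proof -
    have "\<not> real (Suc n) * s \<le> 0"
      using True by (metis mult_pos_pos not_le of_nat_0_less_iff zero_less_Suc)
    then show ?thesis by (simp only: flat_def if_False) (simp add: power_int_minus del: of_nat_Suc)
  qed
  ultimately show ?thesis using True by (simp only: if_True)
next
  case False
  then have "real (Suc n) * s \<le> 0" for n by (simp add: mult_le_0_iff)
  then show ?thesis using False by (simp add: flat_def)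
qed

lemma abs_L2_inner_le:
  assumes "square_int f" "square_int g"
  shows "\<bar>L2_inner f g\<bar> \<le> (L2_norm f)\<^sup>2 + (L2_norm g)\<^sup>2"
proof -
  have "\<bar>L2_inner f g\<bar> \<le> (LINT x|torus. \<bar>f x \<bullet> g x\<bar>)"
    unfolding L2_inner_def by (rule integral_abs_bound)
  also have "\<dots> \<le> (LINT x|torus. (norm (f x))\<^sup>2 + (norm (g x))\<^sup>2)"
    using assms abs_inner_le[of 1 "f _" "g _"]
    by (intro integral_mono integrable_abs integrable_square_int_inner) (auto simp: square_int_def)
  also have "\<dots> = (L2_norm f)\<^sup>2 + (L2_norm g)\<^sup>2"
    using assms by (simp add: square_int_def L2_norm_power2)
  finally show ?thesis .
qed

lemma wave_cross_div_free: "div_field (\<lambda>x. wave k a x *\<^sub>R c *\<^sub>R cross3 k e) x = 0"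
proof -
  have "div_field (\<lambda>x. wave k a x *\<^sub>R c *\<^sub>R cross3 k e) x
      = 2 * pi * wave k (a + pi/2) x * c * (k \<bullet> cross3 k e)"
    by (subst div_field_eq[OF has_derivative_scaleR_left[OF wave_has_derivative]])
      (simp add: inner_axis inner_vec_def[of k] sum_distrib_left algebra_simps)
  then show ?thesis by (simp add: dot_cross_self)
qed

lemma separated_test_function:
  assumes T: "T > 0" and k: "k \<in> freq" and c: "c < T" and n: "n > 0"
  shows "(\<lambda>t x. (flat 1 (n * (c - t)) * wave k a x) *\<^sub>R d *\<^sub>R cross3 k e) \<in> test_functions T"
    (is "?\<phi> \<in> _")
  unfolding test_functions_def mem_Collect_eq
proof (intro conjI ballI allI)
  show "smooth_on ({0..<T} \<times> UNIV) (\<lambda>(t, x). ?\<phi> t x)"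
    unfolding smooth_on_def using flat_wave_C_on[OF approachable_slabs(1)[OF T]] by blast
  show "periodic (?\<phi> t)" for t
    using periodic_wave[OF k, of a] by (simp add: periodic_def)
  show "div_field (?\<phi> t) x = 0" for t x
    using wave_cross_div_free[of k a "flat 1 (n * (c - t)) * d" e x] by (simp add: mult.commute mult.left_commute)
  show "\<exists>T'<T. \<forall>t\<in>{0..<T}. T' \<le> t \<longrightarrow> (\<forall>x. ?\<phi> t x = 0)"
    using c n by (intro exI[of _ c]) (auto simp: flat_def mult_le_0_iff)
qed

text \<open>
  Since the nonlinear term drops out, testing with $\zeta(t)\psi(x)$, where $\psi$ is a solenoidal
  wave, shows that $\int \zeta' (u,\psi)\,dt = -\zeta(0)(u_0,\psi)$. Taking $\zeta'$ to approximate
  the indicator function of $(0,c)$ yields $\int_0^c (u,\psi)\,dt = c\,(u_0,\psi)$ for all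
  $c$ in $(0,T)$, so $(u,\psi)$ is constant in time.
\<close>

lemma weak_Euler_mode_const:
  assumes T: "T > 0" and u0: "u0 \<in> H_space" and W: "weak_Euler T u0 u" and B: "Beltrami T lam u"
    and k: "k \<in> freq"
  shows "AE t in lborel. t \<in> {0<..<T} \<longrightarrow>
    L2_inner (u t) (\<lambda>x. wave k a x *\<^sub>R cross3 k e) = L2_inner u0 (\<lambda>x. wave k a x *\<^sub>R cross3 k e)"
proof -
  let ?I = "{0<..<T}"
  let ?Q = "cbox 0 One :: (real ^ 3) set"
  define \<psi> where "\<psi> = (\<lambda>x. wave k a x *\<^sub>R cross3 k e)"
  define g0 where "g0 = L2_inner u0 \<psi>"
  have psi: "continuous_on A \<psi>" for A unfolding \<psi>_def by (intro continuous_intros)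
  have spsi: "square_int \<psi>" by (rule square_int_continuous[OF psi])
  have Linf: "u \<in> Linf_H T" using W by (simp add: weak_Euler_def)
  obtain U where U: "U \<in> borel_measurable borel"
      "AE p in lborel. fst p \<in> ?I \<longrightarrow> u (fst p) (snd p) = U p"
    using Borel_representative Linf unfolding Linf_H_def by blast
  define g where "g = (\<lambda>t. LINT x|lborel. indicator ?Q x *\<^sub>R (U (t, x) \<bullet> \<psi> x))"
  have g: "g \<in> borel_measurable borel"
  proof -
    have [measurable]: "U \<in> borel \<Otimes>\<^sub>M borel \<rightarrow>\<^sub>M borel" using U(1) by (simp add: borel_prod)
    have [measurable]: "\<psi> \<in> borel \<rightarrow>\<^sub>M borel" using psi by (rule borel_measurable_continuous_onI)
    have "(\<lambda>(t, x). indicator ?Q x *\<^sub>R (U (t, x) \<bullet> \<psi> x)) \<in> borel_measurable (borel \<Otimes>\<^sub>M lborel)"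
      by measurable
    then show ?thesis unfolding g_def by (rule lborel.borel_measurable_lebesgue_integral)
  qed
  have ug: "AE t in lborel. t \<in> ?I \<longrightarrow> L2_inner (u t) \<psi> = g t"
  proof -
    have "AE p in lborel \<Otimes>\<^sub>M lborel. fst p \<in> ?I \<longrightarrow> u (fst p) (snd p) = U p"
      using U(2) by (simp only: lborel_prod)
    from lborel_pair.AE_pair[OF this] show ?thesis
    proof eventually_elim
      case (elim t)
      show ?case
      proof
        assume t: "t \<in> ?I"
        show "L2_inner (u t) \<psi> = g t"
          unfolding L2_inner_def torus_def g_def
        proof (rule integral_lebesgue_on_eq_borel)
          show "(\<lambda>x. U (t, x) \<bullet> \<psi> x) \<in> borel_measurable borel"
            by (intro borel_measurable_inner measurable_compose[OF _ U(1)] borel_measurable_continuous_onI[OF psi]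
                borel_measurable_Pair) auto
          show "AE x in lebesgue_on ?Q. u t x \<bullet> \<psi> x = U (t, x) \<bullet> \<psi> x"
            unfolding AE_lebesgue_on_iff[OF borel_closed[OF closed_cbox]]
            using elim t by (auto elim!: eventually_mono)
        qed auto
      qed
    qed
  qed
  have I: "?I \<in> sets borel" by simp
  obtain C where "AE t in lebesgue_on ?I. u t \<in> H_space \<and> L2_norm (u t) \<le> C"
    using Linf unfolding Linf_H_def by blast
  then have C: "AE t in lborel. t \<in> ?I \<longrightarrow> u t \<in> H_space \<and> L2_norm (u t) \<le> C"
    by (rule AE_lebesgue_on_iff[OF I, THEN iffD1])
  define K where "K = C\<^sup>2 + (L2_norm \<psi>)\<^sup>2"
  have gK: "AE t in lborel. t \<in> ?I \<longrightarrow> \<bar>g t\<bar> \<le> K"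
    using ug C
  proof eventually_elim
    case (elim t)
    show ?case
    proof
      assume t: "t \<in> ?I"
      then have "\<bar>g t\<bar> \<le> (L2_norm (u t))\<^sup>2 + (L2_norm \<psi>)\<^sup>2"
        using elim abs_L2_inner_le[OF H_space_square_int spsi, of "u t"] by simp
      moreover have "(L2_norm (u t))\<^sup>2 \<le> C\<^sup>2" using elim t L2_norm_nonneg by (intro power_mono) auto
      ultimately show "\<bar>g t\<bar> \<le> K" by (simp add: K_def)
    qed
  qed
  have stress: "AE t in lborel. t \<in> ?I \<longrightarrow>
      (\<forall>\<phi>\<in>smooth_torus. (\<forall>x. div_field \<phi> x = 0) \<longrightarrow> L2_inner (\<lambda>x. outer (u t x) (u t x)) (Jac \<phi>) = 0)"
  proof -
    have "AE t in lborel. t \<in> ?I \<longrightarrow> has_distr_curl (u t) (\<lambda>x. lam t *\<^sub>R u t x)"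
      using B unfolding Beltrami_def by (rule AE_lebesgue_on_iff[OF I, THEN iffD1])
    with C show ?thesis
    proof eventually_elim
      case (elim t)
      then show ?case using Beltrami_stress_orthogonal_weak by blast
    qed
  qed
  define \<eta> where "\<eta> = (\<lambda>y. flat 0 y + flat (- 1) y)"
  have chi: "continuous_on UNIV \<eta>"
    unfolding \<eta>_def
    by (intro continuous_on_add) (meson DERIV_isCont continuous_at_imp_continuous_on flat_has_real_derivative)+
  have key: "(LINT t|lborel. indicator ?I t *\<^sub>R (\<eta> (real (Suc n) * (c - t)) * g t)) = c * exp (- 1 / (real (Suc n) * c)) * g0"
    if c: "c \<in> ?I" for c n
  proof -
    let ?N = "real (Suc n)"
    \<comment> \<open>The time factor is $-\frac1N\,\mathit{flat}_1(N(c-t))$, whose derivative is \<open>\<eta>\<close> at $N(c-t)$;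
      it vanishes from time \<open>c\<close> on.\<close>
    let ?\<phi> = "\<lambda>t x. (flat 1 (?N * (c - t)) * wave k a x) *\<^sub>R (- 1 / ?N) *\<^sub>R cross3 k e"
    have phi: "?\<phi> t = (\<lambda>x. wave k a x *\<^sub>R (flat 1 (?N * (c - t)) * (- 1 / ?N)) *\<^sub>R cross3 k e)" for t
      by (simp add: fun_eq_iff mult_ac)
    have vd: "vector_derivative (\<lambda>s. ?\<phi> s x) (at t) = \<eta> (?N * (c - t)) *\<^sub>R \<psi> x" for t x
    proof (rule vector_derivative_at)
      have "((\<lambda>s. ?N * (c - s)) has_real_derivative - ?N) (at t)"
        by (auto intro!: derivative_eq_intros)
      from DERIV_chain'[OF this flat_has_real_derivative[of 1]]
      have "((\<lambda>s. flat 1 (?N * (c - s))) has_real_derivative \<eta> (?N * (c - t)) * - ?N) (at t)"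
        by (simp add: \<eta>_def del: of_nat_Suc)
      from has_vector_derivative_scaleR[OF this has_vector_derivative_const]
      have "((\<lambda>s. flat 1 (?N * (c - s)) *\<^sub>R (- 1 / ?N) *\<^sub>R \<psi> x) has_vector_derivative
          (\<eta> (?N * (c - t)) * - ?N) *\<^sub>R (- 1 / ?N) *\<^sub>R \<psi> x) (at t)"
        by (simp only: scaleR_zero_right add_0_left)
      then show "((\<lambda>s. ?\<phi> s x) has_vector_derivative \<eta> (?N * (c - t)) *\<^sub>R \<psi> x) (at t)"
        by (simp add: \<psi>_def mult_ac del: of_nat_Suc)
    qed
    have test: "?\<phi> \<in> test_functions T"
      using c by (intro separated_test_function T k) auto
    have "(LINT t|lebesgue_on ?I. L2_inner (u t) (\<lambda>x. vector_derivative (\<lambda>s. ?\<phi> s x) (at t))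
          + L2_inner (\<lambda>x. outer (u t x) (u t x)) (Jac (?\<phi> t))) = - L2_inner u0 (?\<phi> 0)"
      by (rule bspec[OF conjunct2[OF W[unfolded weak_Euler_def]] test])
    moreover have "- L2_inner u0 (?\<phi> 0) = c * exp (- 1 / (?N * c)) * g0"
    proof -
      have "?N * c > 0" using c by (intro mult_pos_pos) auto
      then have "flat 1 (?N * (c - 0)) = ?N * c * exp (- 1 / (?N * c))"
        by (simp only: flat_def not_le[symmetric] diff_zero if_False power_int_1_right)
      then have "?\<phi> 0 = (\<lambda>x. (- (c * exp (- 1 / (?N * c)))) *\<^sub>R \<psi> x)"
        by (simp add: fun_eq_iff \<psi>_def mult_ac del: of_nat_Suc)
      then show ?thesis by (simp add: L2_inner_def g0_def)
    qed
    moreover have "(LINT t|lebesgue_on ?I. L2_inner (u t) (\<lambda>x. vector_derivative (\<lambda>s. ?\<phi> s x) (at t))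
          + L2_inner (\<lambda>x. outer (u t x) (u t x)) (Jac (?\<phi> t)))
        = (LINT t|lborel. indicator ?I t *\<^sub>R (\<eta> (?N * (c - t)) * g t))"
    proof (rule integral_lebesgue_on_eq_borel)
      have "(\<lambda>t. \<eta> (?N * (c - t))) \<in> borel_measurable borel"
        by (intro borel_measurable_continuous_onI continuous_on_compose2[OF chi] continuous_intros) auto
      then show "(\<lambda>t. \<eta> (?N * (c - t)) * g t) \<in> borel_measurable borel"
        using g by (rule borel_measurable_times)
      have "AE t in lborel. t \<in> ?I \<longrightarrow> L2_inner (u t) (\<lambda>x. vector_derivative (\<lambda>s. ?\<phi> s x) (at t))
          + L2_inner (\<lambda>x. outer (u t x) (u t x)) (Jac (?\<phi> t)) = \<eta> (?N * (c - t)) * g t"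
        using ug stress
      proof eventually_elim
        case (elim t)
        have "L2_inner (\<lambda>x. outer (u t x) (u t x)) (Jac (?\<phi> t)) = 0" if "t \<in> ?I"
          using elim(2) that wave_smooth_torus[OF k] wave_cross_div_free unfolding phi by blast
        moreover have "L2_inner (u t) (\<lambda>x. vector_derivative (\<lambda>s. ?\<phi> s x) (at t))
            = \<eta> (?N * (c - t)) * L2_inner (u t) \<psi>"
          unfolding vd L2_inner_def by simp
        ultimately show ?case using elim(1) by simp
      qed
      then show "AE t in lebesgue_on ?I. L2_inner (u t) (\<lambda>x. vector_derivative (\<lambda>s. ?\<phi> s x) (at t))
          + L2_inner (\<lambda>x. outer (u t x) (u t x)) (Jac (?\<phi> t)) = \<eta> (?N * (c - t)) * g t"
        by (subst AE_lebesgue_on_iff) auto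
    qed auto
    ultimately show ?thesis by simp
  qed
  have iI: "integrable lborel (\<lambda>t. indicator ?I t :: real)"
    using T by (intro integrable_real_indicator) auto
  have ig: "integrable lborel (\<lambda>t. indicator ?I t * g t)"
  proof (rule Bochner_Integration.integrable_bound)
    show "integrable lborel (\<lambda>t. K * indicator ?I t)" using iI by simp
    show "AE t in lborel. norm (indicator ?I t * g t) \<le> norm (K * indicator ?I t)"
      using gK by eventually_elim (auto simp: indicator_def)
  qed (use g in simp)
  have limit: "(LINT t|lborel. indicator {0<..<c} t * (g t - g0)) = 0" if c: "c \<in> ?I" for c
  proof -
    have "(\<lambda>n. LINT t|lborel. indicator ?I t *\<^sub>R (\<eta> (real (Suc n) * (c - t)) * g t))
        \<longlonglongrightarrow> (LINT t|lborel. indicator {0<..<c} t * g t)"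
    proof (rule integral_dominated_convergence[where w = "\<lambda>t. 2 * (K * indicator ?I t)"])
      show "integrable lborel (\<lambda>t. 2 * (K * indicator ?I t))" using iI by simp
      show "AE t in lborel. (\<lambda>n. indicator ?I t *\<^sub>R (\<eta> (real (Suc n) * (c - t)) * g t)) \<longlonglongrightarrow> indicator {0<..<c} t * g t"
      proof (rule AE_I2)
        fix t
        have "(\<lambda>n. indicator ?I t *\<^sub>R (\<eta> (real (Suc n) * (c - t)) * g t)) \<longlonglongrightarrow> indicator ?I t *\<^sub>R ((if c - t > 0 then 1 else 0) * g t)"
          unfolding \<eta>_def by (intro tendsto_intros flat_sum_tendsto)
        also have "indicator ?I t *\<^sub>R ((if c - t > 0 then 1 else 0) * g t) = indicator {0<..<c} t * g t"
          using c by (auto simp: indicator_def)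
        finally show "(\<lambda>n. indicator ?I t *\<^sub>R (\<eta> (real (Suc n) * (c - t)) * g t)) \<longlonglongrightarrow> indicator {0<..<c} t * g t" .
      qed
      show "AE t in lborel. norm (indicator ?I t *\<^sub>R (\<eta> (real (Suc n) * (c - t)) * g t)) \<le> 2 * (K * indicator ?I t)" for n
        using gK
      proof eventually_elim
        case (elim t)
        show ?case
        proof (cases "t \<in> ?I")
          case True
          have "\<bar>\<eta> (real (Suc n) * (c - t))\<bar> \<le> 2"
            using flat_sum_bounds[of "real (Suc n) * (c - t)"] unfolding \<eta>_def by linarith
          then have "\<bar>\<eta> (real (Suc n) * (c - t))\<bar> * \<bar>g t\<bar> \<le> 2 * K"
            using elim True by (intro mult_mono) auto
          then show ?thesis using True by (simp add: abs_mult)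
        qed simp
      qed
      show "(\<lambda>t. indicator ?I t *\<^sub>R (\<eta> (real (Suc n) * (c - t)) * g t)) \<in> borel_measurable lborel" for n
        using g by (intro borel_measurable_scaleR borel_measurable_times borel_measurable_indicator)
          (auto intro!: borel_measurable_continuous_onI continuous_on_compose2[OF chi] continuous_intros)
      show "(\<lambda>t. indicator {0<..<c} t * g t) \<in> borel_measurable lborel" using g by simp
    qed
    moreover have "(\<lambda>n. c * exp (- 1 / (real (Suc n) * c)) * g0) \<longlonglongrightarrow> c * exp 0 * g0"
    proof (intro tendsto_intros)
      show "(\<lambda>n. - 1 / (real (Suc n) * c)) \<longlonglongrightarrow> 0" using c by real_asymp
    qed
    ultimately have 1: "(LINT t|lborel. indicator {0<..<c} t * g t) = c * g0"
      unfolding key[OF c] using LIMSEQ_unique by fastforce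
    have 2: "integrable lborel (\<lambda>t. indicator {0<..<c} t * g t)"
    proof -
      have "(\<lambda>t. indicator {0<..<c} t *\<^sub>R (indicator ?I t * g t)) = (\<lambda>t. indicator {0<..<c} t * g t)"
        using c by (auto simp: indicator_def)
      then show ?thesis using integrable_mult_indicator[OF _ ig, of "{0<..<c}"] by simp
    qed
    have "(LINT t|lborel. indicator {0<..<c} t * (g t - g0))
        = (LINT t|lborel. indicator {0<..<c} t * g t - g0 * indicator {0<..<c} t)"
      by (intro Bochner_Integration.integral_cong) (auto simp: algebra_simps)
    also have "\<dots> = c * g0 - g0 * c"
      using c 1 2 by (subst Bochner_Integration.integral_diff) auto
    finally show ?thesis by simp
  qed
  have "integrable lborel (\<lambda>t. indicator ?I t * (g t - g0))"
    using Bochner_Integration.integrable_diff[OF ig integrable_mult_right[OF iI, of g0]]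
    by (simp add: algebra_simps)
  then have "AE t in lborel. t \<in> ?I \<longrightarrow> g t - g0 = 0"
    by (rule AE_eq_0_if_initial_integrals_eq_0[OF T _ limit])
  with ug show ?thesis
    unfolding \<psi>_def[symmetric] g0_def[symmetric] by eventually_elim auto
qed

text \<open>
  Solenoidal waves determine the Fourier coefficient of a solenoidal field: the difference \<open>d\<close> of
  the coefficients is both parallel and orthogonal to \<open>k\<close>.
\<close>

lemma coef_eq_if_modes_eq:
  assumes f: "f \<in> H_space" and g: "g \<in> H_space" and k: "k \<in> freq"
    and eq: "\<And>i. L2_inner f (\<lambda>x. wave k a x *\<^sub>R cross3 k (axis i 1)) = L2_inner g (\<lambda>x. wave k a x *\<^sub>R cross3 k (axis i 1))"
  shows "coef f k a = coef g k a"
proof (cases "k = 0")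
  case True
  then show ?thesis by (simp add: H_space_coef_0 f g)
next
  case False
  define d where "d = coef f k a - coef g k a"
  have "cross3 d k $ i = 0" for i
  proof -
    have "d \<bullet> cross3 k (axis i 1) = 0"
      using eq[of i] unfolding d_def inner_diff_left L2_inner_def
        coef_inner[OF H_space_square_int[OF f]] coef_inner[OF H_space_square_int[OF g]] by simp
    then have "cross3 d k \<bullet> axis i 1 = 0" by (simp add: cross3_simps)
    then show ?thesis by (simp add: inner_axis)
  qed
  then have "cross3 d k = 0" by (simp add: vec_eq_iff)
  moreover have "d \<bullet> k = 0"
    by (simp add: d_def inner_diff_left H_space_coef_div[OF f k] H_space_coef_div[OF g k])
  moreover have "(d \<bullet> d) * (k \<bullet> k) = cross3 d k \<bullet> cross3 d k + (d \<bullet> k)\<^sup>2"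
    by (simp add: cross3_def inner_vec_def sum_3 power2_eq_square algebra_simps)
  ultimately have "(d \<bullet> d) * (k \<bullet> k) = 0" by simp
  then show ?thesis using False by (simp add: d_def)
qed

text \<open>
  For almost every time $u(t)$ has the Fourier coefficients of $u_0$; countably many test waves
  suffice. Both are then equal to the trigonometric polynomial that represents $u(t)$ at one good
  time.
\<close>

lemma weak_Euler_Beltrami_stationary:
  assumes T: "T > 0" and u0: "u0 \<in> H_space" and W: "weak_Euler T u0 u" and B: "Beltrami T lam u"
  shows "\<exists>v l. v \<in> smooth_torus \<and> (\<forall>x. div_field v x = 0) \<and> (\<forall>x. curl v x = l *\<^sub>R v x)
    \<and> (AE x in torus. u0 x = v x)
    \<and> (AE t in lborel. t \<in> {0<..<T} \<longrightarrow> (AE x in torus. u t x = v x))"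
proof -
  let ?I = "{0<..<T}"
  have I: "?I \<in> sets borel" by simp
  let ?P = "\<lambda>t v l. v \<in> smooth_torus \<and> (\<forall>x. div_field v x = 0) \<and> (\<forall>x. curl v x = l *\<^sub>R v x)
      \<and> (AE x in torus. u0 x = v x) \<and> (AE x in torus. u t x = v x)"
  have modes: "AE t in lborel. \<forall>k\<in>freq. \<forall>a\<in>{0, pi/2}. \<forall>i\<in>UNIV. t \<in> ?I \<longrightarrow>
      L2_inner (u t) (\<lambda>x. wave k a x *\<^sub>R cross3 k (axis i 1)) = L2_inner u0 (\<lambda>x. wave k a x *\<^sub>R cross3 k (axis i 1))"
    by (intro AE_ball_countable[THEN iffD2] ballI countable_freq weak_Euler_mode_const[OF T u0 W B])
      (auto intro: countable_finite)
  have "AE t in lebesgue_on ?I. u t \<in> H_space"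
    using W unfolding weak_Euler_def Linf_H_def by (auto elim: eventually_mono)
  then have H: "AE t in lborel. t \<in> ?I \<longrightarrow> u t \<in> H_space" by (rule AE_lebesgue_on_iff[OF I, THEN iffD1])
  have C: "AE t in lborel. t \<in> ?I \<longrightarrow> has_distr_curl (u t) (\<lambda>x. lam t *\<^sub>R u t x)"
    using B unfolding Beltrami_def by (rule AE_lebesgue_on_iff[OF I, THEN iffD1])
  have ex: "AE t in lborel. t \<in> ?I \<longrightarrow> (\<exists>v l. ?P t v l)"
    using modes H C
  proof eventually_elim
    case (elim t)
    show ?case
    proof
      assume t: "t \<in> ?I"
      have ut: "u t \<in> H_space" using elim t by blast
      obtain v where v: "v \<in> smooth_torus" "\<And>x. div_field v x = 0" "\<And>x. curl v x = lam t *\<^sub>R v x"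
          "AE x in torus. u t x = v x"
        using Beltrami_field_smooth[OF ut] elim(3) t by blast
      have sv: "square_int v" by (rule square_int_continuous[OF smooth_torus_continuous[OF v(1)]])
      have "coef u0 k a = coef v k a" if k: "k \<in> freq" for k a
      proof -
        have "coef (u t) k b = coef u0 k b" if "b \<in> {0, pi/2}" for b
          using elim(1) k t that by (intro coef_eq_if_modes_eq[OF ut u0 k]) blast
        then have "coef (u t) k a = coef u0 k a"
          using coef_phase[OF H_space_square_int[OF ut], of k a] coef_phase[OF H_space_square_int[OF u0], of k a]
          by simp
        moreover have "coef (u t) k a = coef v k a"
          unfolding coef_def
        proof (rule integral_cong_AE)
          show "(\<lambda>x. wave k a x *\<^sub>R u t x) \<in> borel_measurable torus" "(\<lambda>x. wave k a x *\<^sub>R v x) \<in> borel_measurable torus"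
            by (intro borel_measurable_integrable integrable_wave_scaleR H_space_square_int ut sv)+
          show "AE x in torus. wave k a x *\<^sub>R u t x = wave k a x *\<^sub>R v x"
            using v(4) by eventually_elim simp
        qed
        ultimately show ?thesis by simp
      qed
      then have "AE x in torus. u0 x = v x" by (rule AE_eq_if_coef_eq[OF u0 v(1)])
      then show "\<exists>v l. ?P t v l" using v by blast
    qed
  qed
  \<comment> \<open>A good time exists because the interval has positive measure.\<close>
  obtain t0 where "t0 \<in> ?I" "\<exists>v l. ?P t0 v l"
  proof (rule ccontr)
    assume "\<not> thesis"
    then have no: "\<And>t. t \<in> ?I \<Longrightarrow> \<not> (\<exists>v l. ?P t v l)" using that by blast
    have "AE t in lborel. t \<notin> ?I" using ex
    proof eventually_elim
      case (elim t)
      show ?case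
      proof
        assume t: "t \<in> ?I"
        from no[OF t] elim[rule_format, OF t] show False by (rule notE)
      qed
    qed
    then have "emeasure lborel ?I = 0"
      by (rule AE_iff_measurable[THEN iffD1, rotated 2]) auto
    then show False using T by simp
  qed
  then obtain v l where v: "?P t0 v l" by blast
  show ?thesis
  proof (intro exI conjI)
    show "AE t in lborel. t \<in> ?I \<longrightarrow> (AE x in torus. u t x = v x)"
      using ex
    proof eventually_elim
      case (elim t)
      show ?case
      proof
        assume "t \<in> ?I"
        then obtain v' l' where "?P t v' l'" using elim by blast
        then have 1: "AE x in torus. u0 x = v' x" and 2: "AE x in torus. u t x = v' x" by blast+
        have 3: "AE x in torus. u0 x = v x" using v by blast
        show "AE x in torus. u t x = v x" using 1 2 3 by eventually_elim simp
      qed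
    qed
  qed (rule v[THEN conjunct1] v[THEN conjunct2, THEN conjunct1] v[THEN conjunct2, THEN conjunct2, THEN conjunct1]
      v[THEN conjunct2, THEN conjunct2, THEN conjunct2, THEN conjunct1])+
qed

text \<open>
  Fubini in the converse direction: equality on almost every time slice implies equality almost
  everywhere on the slab, because the exceptional set of a Borel representative is Borel.
\<close>

lemma AE_slab_eq:
  fixes u :: "real \<Rightarrow> real ^ 3 \<Rightarrow> real ^ 3"
  assumes u: "u \<in> Linf_H T" and v: "v \<in> smooth_torus"
    and eq: "AE t in lborel. t \<in> {0<..<T} \<longrightarrow> (AE x in torus. u t x = v x)"
  shows "AE (t, x) in lebesgue_on ({0<..<T} \<times> UNIV). u t x = v x"
proof -
  let ?I = "{0<..<T}"
  have per: "periodic (u t)" if "t \<in> ?I" for t using u that by (simp add: Linf_H_def)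
  obtain U where U: "U \<in> borel_measurable borel"
      "AE p in lborel. fst p \<in> ?I \<longrightarrow> u (fst p) (snd p) = U p"
    using Borel_representative u unfolding Linf_H_def by blast
  have U': "AE p in lborel \<Otimes>\<^sub>M lborel. fst p \<in> ?I \<longrightarrow> u (fst p) (snd p) = U p"
    using U(2) by (simp only: lborel_prod)
  let ?h = "\<lambda>p. indicator ?I (fst p) * norm (U p - v (snd p)) :: real"
  have "AE p in lborel \<Otimes>\<^sub>M lborel. ?h p = 0"
  proof (rule lborel_pair.AE_pair_measure)
    have fst: "fst \<in> borel_measurable (borel :: (real \<times> (real ^ 3)) measure)"
      and snd: "snd \<in> borel_measurable (borel :: (real \<times> (real ^ 3)) measure)"
      by (intro borel_measurable_continuous_onI continuous_intros)+
    have "v \<in> borel_measurable borel"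
      by (rule borel_measurable_continuous_onI[OF smooth_torus_continuous[OF v]])
    have vs: "(\<lambda>p. v (snd p)) \<in> borel_measurable (borel :: (real \<times> (real ^ 3)) measure)"
      by (rule measurable_compose[OF snd \<open>v \<in> borel_measurable borel\<close>])
    have "(\<lambda>p. norm (U p - v (snd p))) \<in> borel_measurable borel"
      by (rule measurable_compose[OF borel_measurable_diff[OF U(1) vs] borel_measurable_norm])
    moreover have "(\<lambda>p. indicator ?I (fst p) :: real) \<in> borel_measurable (borel :: (real \<times> (real ^ 3)) measure)"
      by (rule measurable_compose[OF fst borel_measurable_indicator]) simp
    ultimately have h: "?h \<in> borel_measurable borel" by (intro borel_measurable_times)
    have "?h -` {0} \<inter> space borel \<in> sets borel" by (rule measurable_sets[OF h]) simp
    then show "{p \<in> space (lborel \<Otimes>\<^sub>M lborel). ?h p = 0} \<in> sets (lborel \<Otimes>\<^sub>M lborel)"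
      unfolding lborel_prod by (simp add: vimage_def)
    show "AE t in lborel. AE x in lborel. ?h (t, x) = 0"
      using eq lborel_pair.AE_pair[OF U']
    proof eventually_elim
      case (elim t)
      show ?case
      proof (cases "t \<in> ?I")
        case True
        have "AE x in torus. u t x - v x = 0" using elim(1) True by simp
        moreover have "periodic (\<lambda>x. u t x - v x)"
          using per[OF True] v by (simp add: periodic_def smooth_torus_def)
        ultimately have "AE x in lborel. u t x - v x = 0" by (rule AE_torus_imp_AE_lborel[rotated])
        then show ?thesis using elim(2) by eventually_elim (use True in auto)
      qed simp
    qed
  qed
  then have "AE p in lborel. ?h p = 0" by (simp only: lborel_prod)
  with U(2) have "AE p in lborel. p \<in> ?I \<times> UNIV \<longrightarrow> (case p of (t, x) \<Rightarrow> u t x = v x)"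
    by eventually_elim (auto simp: case_prod_beta mem_Times_iff)
  then show ?thesis
    by (rule AE_lebesgue_on_iff[THEN iffD2, rotated]) (intro borel_open open_Times; simp)
qed

theorem proposition1p2:
  fixes T :: real
    and p :: ennreal
    and lam :: "real \<Rightarrow> real"
    and u0 :: "real ^ 3 \<Rightarrow> real ^ 3"
    and u :: "real \<Rightarrow> real ^ 3 \<Rightarrow> real ^ 3"
  assumes "T > 0"
    and "u0 \<in> Sobolev2 3 \<inter> H_space"
    and "weak_Euler T u0 u"
    and "p \<ge> 3"
    and "lam \<in> Lp_interval p T"
    and "Beltrami T lam u"
  shows "\<exists>v. (AE (t, x) in lebesgue_on ({0<..<T} \<times> UNIV). u t x = v t x)
           \<and> classical_Euler T u0 v
           \<and> (\<forall>w. classical_Euler T u0 w \<longrightarrow> (\<forall>t\<in>{0..T}. \<forall>x. w t x = v t x))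
           \<and> (\<forall>t\<in>{0..T}. L2_norm (v t) = L2_norm u0)"
proof -
  have u0: "u0 \<in> H_space" using assms(2) by blast
  obtain v l where "v \<in> smooth_torus \<and> (\<forall>x. div_field v x = 0) \<and> (\<forall>x. curl v x = l *\<^sub>R v x)
      \<and> (AE x in torus. u0 x = v x)
      \<and> (AE t in lborel. t \<in> {0<..<T} \<longrightarrow> (AE x in torus. u t x = v x))"
    using weak_Euler_Beltrami_stationary[OF assms(1) u0 assms(3,6)] by (elim exE)
  then have v: "v \<in> smooth_torus" "\<And>x. div_field v x = 0" "\<And>x. curl v x = l *\<^sub>R v x"
      and u0v: "AE x in torus. u0 x = v x"
      and uv: "AE t in lborel. t \<in> {0<..<T} \<longrightarrow> (AE x in torus. u t x = v x)"
    by blast+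
  have "u \<in> Linf_H T" using assms(3) by (simp add: weak_Euler_def)
  from AE_slab_eq[OF this v(1) uv]
  have ae: "AE (t, x) in lebesgue_on ({0<..<T} \<times> UNIV). u t x = v x" .
  have "AE x in torus. v x = u0 x" using u0v by eventually_elim simp
  then have cl: "classical_Euler T u0 (\<lambda>t. v)"
    by (rule Beltrami_stationary_classical[OF assms(1) v])
  have "L2_inner v v = L2_inner u0 u0"
    unfolding L2_inner_def
  proof (rule integral_cong_AE)
    have "square_int v" by (rule square_int_continuous[OF smooth_torus_continuous[OF v(1)]])
    then show "(\<lambda>x. v x \<bullet> v x) \<in> borel_measurable torus" "(\<lambda>x. u0 x \<bullet> u0 x) \<in> borel_measurable torus"
      using H_space_square_int[OF u0] by (auto intro: borel_measurable_integrable integrable_square_int_inner)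
    show "AE x in torus. v x \<bullet> v x = u0 x \<bullet> u0 x" using u0v by eventually_elim simp
  qed
  then have norm: "L2_norm v = L2_norm u0" by (simp add: L2_norm_def)
  show ?thesis
    by (intro exI[of _ "\<lambda>t. v"] conjI allI impI ballI ae cl norm classical_Euler_unique[OF assms(1) cl])
qed

end
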